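(* For an integer $d\ge2$, let $\Delta_d=\left\lfloor(d-1)\left(1-\frac1d\right)^{d-1}\right\rfloor$. If at most $d$ candidates are ranked first (by some voter) in each round, then the first-choice budget rule is a polynomial-time semi-online rule such that, for every group $S$, the winner is the first choice of some member of $S$ in at least $\lfloor|S||T|/n\rfloor-\Delta_d$ rounds. Consequently, it satisfies all-rank-PJR with additive loss $\Delta_d$. No smaller additive loss that depends only on $d$ suffices for all numbers of voters and all horizons, even for an offline rule and all-rank-wPJR: for every integer $0\le L<\Delta_d$ there is a profile with at most $d$ first choices per round for which no sequence satisfies all-rank-wPJR with additive loss $L$.
   Context: Model. Voters $V=[n]$, a set $C$ of $m$ candidates, rounds $T=\{1,\dots,|T|\}$ with $n,m,|T|\ge1$; $|T|$ is the horizon. In each round $j$ each voter $i$ has a strict complete ranking of $C$; her most-preferred candidate is her first choice in round $j$. For $r\in[m]$, $A_i^j(r)$ is the set of voter $i$'s $r$ most-preferred candidates in round $j$, and $N_c^j(1)$ is the set of voters whose first choice in round $j$ is $c$. A sequence is $W=(w^1,\dots,w^{|T|})\in C^{|T|}$; $w^j$ is the winner of round $j$. A group is a nonempty $S\subseteq V$. A rule is offline if it may use the whole profile; semi-online if each $w^j$ depends only on the rankings in rounds $1,\dots,j$ and on $|T|$. All-rank axioms. A rank matrix is $R=(r_i^j)\in[m]^{|T|\times n}$. Under $R$, a group $S$ agrees in round $j$ if $\bigcap_{i\in S}A_i^j(r_i^j)\ne\varnothing$, and is represented in round $j$ if $w^j\in\bigcup_{i\in S}A_i^j(r_i^j)$.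 For an integer $L\ge0$, $W$ satisfies all-rank-PJR with additive loss $L$ if, for every rank matrix $R$, every group $S$ that agrees in $k>0$ rounds under $R$ is represented in at least $\lfloor k|S|/n\rfloor-L$ rounds. All-rank-wPJR with additive loss $L$ is this requirement restricted to groups agreeing in every round ($k=|T|$). First-choice budget rule. Set $b_i\gets|T|/n$ for every voter. In each round $j=1,\dots,|T|$: choose $w^j$ maximizing $\sum_{i\in N_c^j(1)}b_i$ over candidates $c$ with $N_c^j(1)\ne\varnothing$ (ties by a fixed candidate order); then deduct a total of $\min\{1,\sum_{i\in N_{w^j}^j(1)}b_i\}$ from the budgets of voters in $N_{w^j}^j(1)$, in the order of their indices, exhausting each budget before moving to the next voter. *)

theory Defs
  imports
    Complex_Main
    "HOL-Combinatorics.Multiset_Permutations"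
    "HOL-Computational_Algebra.Polynomial"
begin

section \<open>The model\<close>

text \<open>
  Voters are \<open>{1..n}\<close>, candidates \<open>{1..m}\<close>, rounds \<open>{1..T}\<close>.  A profile maps a round \<open>j\<close> and a
  voter \<open>i\<close> to the ranking \<open>P j i\<close>, a list of all candidates, most preferred first.  Values
  outside these ranges are junk, and every notion below ignores them.
\<close>

type_synonym rankings = "nat \<Rightarrow> nat \<Rightarrow> nat list"

definition profile :: "nat \<Rightarrow> nat \<Rightarrow> nat \<Rightarrow> rankings \<Rightarrow> bool" where
  "profile n m T P \<longleftrightarrow> n \<ge> 1 \<and> m \<ge> 1 \<and> T \<ge> 1 \<and>
     (\<forall>j\<in>{1..T}. \<forall>i\<in>{1..n}. P j i \<in> permutations_of_set {1..m})"

definition top_set :: "rankings \<Rightarrow> nat \<Rightarrow> nat \<Rightarrow> nat \<Rightarrow> nat set" where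
  "top_set P j i r = set (take r (P j i))"

definition first_choice :: "rankings \<Rightarrow> nat \<Rightarrow> nat \<Rightarrow> nat" where
  "first_choice P j i = hd (P j i)"

definition first_voters :: "nat \<Rightarrow> rankings \<Rightarrow> nat \<Rightarrow> nat \<Rightarrow> nat set" where
  "first_voters n P j c = {i\<in>{1..n}. first_choice P j i = c}"

definition first_choices :: "nat \<Rightarrow> nat \<Rightarrow> rankings \<Rightarrow> nat \<Rightarrow> nat set" where
  "first_choices n m P j = {c\<in>{1..m}. first_voters n P j c \<noteq> {}}"

definition at_most_first_choices :: "nat \<Rightarrow> nat \<Rightarrow> nat \<Rightarrow> nat \<Rightarrow> rankings \<Rightarrow> bool" where
  "at_most_first_choices d n m T P \<longleftrightarrow> (\<forall>j\<in>{1..T}. card (first_choices n m P j) \<le> d)"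

definition winner_sequence :: "nat \<Rightarrow> nat \<Rightarrow> (nat \<Rightarrow> nat) \<Rightarrow> bool" where
  "winner_sequence m T W \<longleftrightarrow> (\<forall>j\<in>{1..T}. W j \<in> {1..m})"

definition voter_group :: "nat \<Rightarrow> nat set \<Rightarrow> bool" where
  "voter_group n S \<longleftrightarrow> S \<noteq> {} \<and> S \<subseteq> {1..n}"


section \<open>All-rank axioms\<close>

definition rank_matrix :: "nat \<Rightarrow> nat \<Rightarrow> nat \<Rightarrow> (nat \<Rightarrow> nat \<Rightarrow> nat) \<Rightarrow> bool" where
  "rank_matrix n m T R \<longleftrightarrow> (\<forall>j\<in>{1..T}. \<forall>i\<in>{1..n}. R j i \<in> {1..m})"

definition agrees :: "rankings \<Rightarrow> (nat \<Rightarrow> nat \<Rightarrow> nat) \<Rightarrow> nat set \<Rightarrow> nat \<Rightarrow> bool" where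
  "agrees P R S j \<longleftrightarrow> (\<Inter>i\<in>S. top_set P j i (R j i)) \<noteq> {}"

definition represented ::
    "rankings \<Rightarrow> (nat \<Rightarrow> nat \<Rightarrow> nat) \<Rightarrow> (nat \<Rightarrow> nat) \<Rightarrow> nat set \<Rightarrow> nat \<Rightarrow> bool" where
  "represented P R W S j \<longleftrightarrow> W j \<in> (\<Union>i\<in>S. top_set P j i (R j i))"

definition all_rank_PJR ::
    "nat \<Rightarrow> nat \<Rightarrow> nat \<Rightarrow> rankings \<Rightarrow> nat \<Rightarrow> (nat \<Rightarrow> nat) \<Rightarrow> bool" where
  "all_rank_PJR n m T P L W \<longleftrightarrow>
     (\<forall>R S k. rank_matrix n m T R \<and> voter_group n S \<and>
        k = card {j\<in>{1..T}. agrees P R S j} \<and> k > 0 \<longrightarrow>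
        int (card {j\<in>{1..T}. represented P R W S j})
          \<ge> \<lfloor>real k * real (card S) / real n\<rfloor> - int L)"

definition all_rank_wPJR ::
    "nat \<Rightarrow> nat \<Rightarrow> nat \<Rightarrow> rankings \<Rightarrow> nat \<Rightarrow> (nat \<Rightarrow> nat) \<Rightarrow> bool" where
  "all_rank_wPJR n m T P L W \<longleftrightarrow>
     (\<forall>R S. rank_matrix n m T R \<and> voter_group n S \<and> (\<forall>j\<in>{1..T}. agrees P R S j) \<longrightarrow>
        int (card {j\<in>{1..T}. represented P R W S j})
          \<ge> \<lfloor>real T * real (card S) / real n\<rfloor> - int L)"


section \<open>Rules\<close>

text \<open>A rule maps \<open>n\<close>, \<open>m\<close>, \<open>T\<close> and a profile to a sequence of winners.\<close>

type_synonym rule = "nat \<Rightarrow> nat \<Rightarrow> nat \<Rightarrow> rankings \<Rightarrow> nat \<Rightarrow> nat"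

definition offline_rule :: "rule \<Rightarrow> bool" where
  "offline_rule F \<longleftrightarrow> (\<forall>n m T P. profile n m T P \<longrightarrow> winner_sequence m T (F n m T P))"

definition semi_online_rule :: "rule \<Rightarrow> bool" where
  "semi_online_rule F \<longleftrightarrow> offline_rule F \<and>
     (\<forall>n m T P Q j. profile n m T P \<and> profile n m T Q \<and> j \<in> {1..T} \<and>
        (\<forall>j'\<in>{1..j}. \<forall>i\<in>{1..n}. P j' i = Q j' i) \<longrightarrow>
        F n m T P j = F n m T Q j)"


section \<open>The first-choice budget rule\<close>

definition backing :: "nat \<Rightarrow> rankings \<Rightarrow> nat \<Rightarrow> (nat \<Rightarrow> real) \<Rightarrow> nat \<Rightarrow> real" where
  "backing n P j b c = (\<Sum>i\<in>first_voters n P j c. b i)"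

text \<open>The fixed candidate order that breaks ties is the numerical one.\<close>

definition round_winner :: "nat \<Rightarrow> nat \<Rightarrow> rankings \<Rightarrow> nat \<Rightarrow> (nat \<Rightarrow> real) \<Rightarrow> nat" where
  "round_winner n m P j b =
     (LEAST c. c \<in> first_choices n m P j \<and>
        (\<forall>c'\<in>first_choices n m P j. backing n P j b c' \<le> backing n P j b c))"

text \<open>\<open>deduct is q b\<close> takes a total of \<open>q\<close> from the listed voters, exhausting each before the next.\<close>

fun deduct :: "nat list \<Rightarrow> real \<Rightarrow> (nat \<Rightarrow> real) \<Rightarrow> (nat \<Rightarrow> real)" where
  "deduct [] q b = b"
| "deduct (i # is) q b = deduct is (q - min q (b i)) (b(i := b i - min q (b i)))"

text \<open>\<open>budgets n m T P j\<close> are the budgets after round \<open>j\<close>.\<close>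

primrec budgets :: "nat \<Rightarrow> nat \<Rightarrow> nat \<Rightarrow> rankings \<Rightarrow> nat \<Rightarrow> nat \<Rightarrow> real" where
  "budgets n m T P 0 = (\<lambda>i. real T / real n)"
| "budgets n m T P (Suc j) =
     (let b = budgets n m T P j;
          w = round_winner n m P (Suc j) b
      in deduct (sorted_list_of_set (first_voters n P (Suc j) w))
           (min 1 (backing n P (Suc j) b w)) b)"

definition first_choice_budget_rule :: rule where
  "first_choice_budget_rule n m T P j = round_winner n m P j (budgets n m T P (j - 1))"

definition Delta :: "nat \<Rightarrow> nat" where
  "Delta d = nat \<lfloor>(real d - 1) * (1 - 1 / real d) ^ (d - 1)\<rfloor>"


section \<open>Polynomial time\<close>

text \<open>
  The machine model is a structured random access machine.  Its store has arrays \<open>0, 1, 2, \<dots>\<close> of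
  natural numbers, each with cells \<open>0, 1, 2, \<dots>\<close>; a program mentions finitely many arrays.  The
  arithmetic operations are addition and truncated subtraction, and every operation costs one
  step.  Without multiplication, \<open>t\<close> steps add at most \<open>O(t)\<close> bits to the length of the numbers in
  the store, so polynomial time on this machine is polynomial time on a Turing machine.
\<close>

type_synonym store = "nat \<Rightarrow> nat \<Rightarrow> nat"

datatype expr = Const nat | Cell nat expr | Add expr expr | Sub expr expr

primrec val :: "expr \<Rightarrow> store \<Rightarrow> nat" where
  "val (Const k) s = k"
| "val (Cell a e) s = s a (val e s)"
| "val (Add e f) s = val e s + val f s"
| "val (Sub e f) s = val e s - val f s"

primrec expr_cost :: "expr \<Rightarrow> nat" where
  "expr_cost (Const k) = 1"
| "expr_cost (Cell a e) = 1 + expr_cost e"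
| "expr_cost (Add e f) = 1 + expr_cost e + expr_cost f"
| "expr_cost (Sub e f) = 1 + expr_cost e + expr_cost f"

datatype prog =
    Skip
  | Assign nat expr expr
  | Seq prog prog
  | Cond expr prog prog
  | While expr prog

text \<open>
  \<open>exec c s t s'\<close>: started in store \<open>s\<close>, the program \<open>c\<close> halts after \<open>t\<close> steps in store \<open>s'\<close>.
  \<open>Assign a e f\<close> writes the value of \<open>f\<close> into the cell of array \<open>a\<close> whose index is the value of \<open>e\<close>;
  conditions hold when they are nonzero.
\<close>

inductive exec :: "prog \<Rightarrow> store \<Rightarrow> nat \<Rightarrow> store \<Rightarrow> bool" where
  Skip: "exec Skip s 1 s"
| Assign: "exec (Assign a e f) s (1 + expr_cost e + expr_cost f)
     (s(a := (s a)(val e s := val f s)))"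
| Seq: "exec c s t s' \<Longrightarrow> exec c' s' t' s'' \<Longrightarrow> exec (Seq c c') s (t + t') s''"
| CondTrue: "val e s \<noteq> 0 \<Longrightarrow> exec c s t s' \<Longrightarrow> exec (Cond e c c') s (1 + expr_cost e + t) s'"
| CondFalse: "val e s = 0 \<Longrightarrow> exec c' s t s' \<Longrightarrow> exec (Cond e c c') s (1 + expr_cost e + t) s'"
| WhileTrue: "val e s \<noteq> 0 \<Longrightarrow> exec c s t s' \<Longrightarrow> exec (While e c) s' t' s'' \<Longrightarrow>
     exec (While e c) s (1 + expr_cost e + t + t') s''"
| WhileFalse: "val e s = 0 \<Longrightarrow> exec (While e c) s (1 + expr_cost e) s"

definition encode :: "nat \<Rightarrow> nat \<Rightarrow> nat \<Rightarrow> rankings \<Rightarrow> nat list" where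
  "encode n m T P =
     [n, m, T] @ concat (map (\<lambda>j. concat (map (P j) [1..<n+1])) [1..<T+1])"

text \<open>The input is placed in array \<open>0\<close>; all other cells are \<open>0\<close>.\<close>

definition initial_store :: "nat list \<Rightarrow> store" where
  "initial_store xs = (\<lambda>a p. if a = 0 \<and> p < length xs then xs ! p else 0)"

text \<open>
  The output is read from array \<open>1\<close>: cell \<open>j\<close> holds the winner of round \<open>j\<close>.  The number of steps
  is polynomial in the number of input entries, hence in the bit length of the input.
\<close>

definition polynomial_time_rule :: "rule \<Rightarrow> bool" where
  "polynomial_time_rule F \<longleftrightarrow>
     (\<exists>(c :: prog) (p :: nat poly). \<forall>n m T P. profile n m T P \<longrightarrow>
        (\<exists>t s. exec c (initial_store (encode n m T P)) t s \<and>
           t \<le> poly p (length (encode n m T P)) \<and>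
           (\<forall>j\<in>{1..T}. s 1 j = F n m T P j)))"

end

theory Submission imports Defs "HOL-Library.FuncSet" begin

text \<open>
  Upper bound.  If \<open>B\<close> is the total budget before a round, some first choice is backed by at least
  \<open>B / d\<close>, so the total becomes at most \<open>max (B - 1) ((1 - 1 / d) * B)\<close>.  Starting from \<open>T\<close> it drops
  linearly down to \<open>d\<close> and then geometrically for \<open>d\<close> rounds, which leaves at most
  \<open>d * (1 - 1 / d) ^ d = (d - 1) * (1 - 1 / d) ^ (d - 1)\<close> unspent.  A group pays at most 1 in each
  round won by a first choice of a member and nothing in the other rounds.

  Lower bound.  Take \<open>d\<close> rounds and one voter for each function from rounds to candidates, ranking
  the candidates cyclically from her value on.  For every sequence of winners, the \<open>(d - 1) ^ d\<close>
  voters whose first choice never wins agree in every round on a candidate that all of them rank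
  above the winner, while their proportional share is \<open>d * (1 - 1 / d) ^ d\<close>.
\<close>

section \<open>The budget rule\<close>

lemma first_choice_in:
  assumes "profile n m T P" "j \<in> {1..T}" "i \<in> {1..n}"
  shows "first_choice P j i \<in> {1..m}"
proof -
  have "set (P j i) = {1..m}" "m \<ge> 1"
    using assms by (auto simp: profile_def permutations_of_set_def)
  then show ?thesis
    by (metis atLeastatMost_empty_iff first_choice_def hd_in_set list.set(1) not_less)
qed

lemma first_choice_in_first_choices:
  assumes "profile n m T P" "j \<in> {1..T}" "i \<in> {1..n}"
  shows "first_choice P j i \<in> first_choices n m P j"
  using assms first_choice_in[OF assms] by (auto simp: first_choices_def first_voters_def)

lemma finite_first_choices [simp]: "finite (first_choices n m P j)"
  by (simp add: first_choices_def)

lemma finite_first_voters [simp]: "finite (first_voters n P j c)"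
  by (simp add: first_voters_def)

lemma first_choices_nonempty:
  assumes "profile n m T P" "j \<in> {1..T}"
  shows "first_choices n m P j \<noteq> {}"
proof -
  have "1 \<in> {1..n}" using assms(1) by (simp add: profile_def)
  from first_choice_in_first_choices[OF assms this] show ?thesis by blast
qed

text \<open>The first choices of a round form a finite nonempty set, so some backing is maximal and
  the \<open>LEAST\<close> in \<open>round_winner\<close> is attained.\<close>

lemma
  assumes "profile n m T P" "j \<in> {1..T}"
  shows round_winner_in: "round_winner n m P j b \<in> first_choices n m P j"
    and round_winner_max:
      "c \<in> first_choices n m P j \<Longrightarrow> backing n P j b c \<le> backing n P j b (round_winner n m P j b)"
proof -
  let ?A = "first_choices n m P j" and ?f = "backing n P j b"
  obtain c where "c \<in> ?A" "Max (?f ` ?A) = ?f c"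
    using first_choices_nonempty[OF assms]
    by (meson Max_in finite_first_choices finite_imageI imageE image_is_empty)
  then have "c \<in> ?A \<and> (\<forall>c'\<in>?A. ?f c' \<le> ?f c)"
    by (metis Max_ge finite_first_choices finite_imageI imageI)
  from LeastI[of "\<lambda>c. c \<in> ?A \<and> (\<forall>c'\<in>?A. ?f c' \<le> ?f c)", OF this]
  show "round_winner n m P j b \<in> ?A" "c \<in> ?A \<Longrightarrow> ?f c \<le> ?f (round_winner n m P j b)" for c
    by (auto simp: round_winner_def)
qed

lemma round_winner_cong:
  assumes "\<And>i. i \<in> {1..n} \<Longrightarrow> P j i = Q j i"
  shows "first_voters n P j = first_voters n Q j"
    and "backing n P j = backing n Q j"
    and "round_winner n m P j = round_winner n m Q j"
proof -
  show *: "first_voters n P j = first_voters n Q j"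
    using assms by (auto simp: first_voters_def first_choice_def fun_eq_iff)
  then show **: "backing n P j = backing n Q j"
    by (simp add: backing_def fun_eq_iff)
  show "round_winner n m P j = round_winner n m Q j"
    by (simp add: round_winner_def first_choices_def * ** fun_eq_iff)
qed

text \<open>The recursion reads one round per step. With \<open>k = j - 1\<close> this keeps the
  winner of round \<open>j\<close> independent of later rounds.\<close>

lemma budgets_cong:
  assumes "\<And>j i. j \<in> {1..k} \<Longrightarrow> i \<in> {1..n} \<Longrightarrow> P j i = Q j i"
  shows "budgets n m T P k = budgets n m T Q k"
  using assms
proof (induction k)
  case (Suc k)
  have eq: "P (Suc k) i = Q (Suc k) i" if "i \<in> {1..n}" for i using Suc.prems that by simp
  have eqs: "first_voters n P (Suc k) = first_voters n Q (Suc k)"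
    "backing n P (Suc k) = backing n Q (Suc k)"
    "round_winner n m P (Suc k) = round_winner n m Q (Suc k)"
    using round_winner_cong[of n P "Suc k" Q] eq by blast+
  have "budgets n m T P k = budgets n m T Q k" using Suc by simp
  then show ?case by (simp add: eqs Let_def del: deduct.simps)
qed simp

lemma semi_online_first_choice_budget_rule: "semi_online_rule first_choice_budget_rule"
  unfolding semi_online_rule_def offline_rule_def
proof (intro conjI allI impI)
  fix n m T P assume "profile n m T P"
  then show "winner_sequence m T (first_choice_budget_rule n m T P)"
    using round_winner_in[of n m T P]
    by (fastforce simp: winner_sequence_def first_choice_budget_rule_def first_choices_def)
next
  fix n m T P Q j
  assume A: "profile n m T P \<and> profile n m T Q \<and> j \<in> {1..T} \<and>
    (\<forall>j'\<in>{1..j}. \<forall>i\<in>{1..n}. P j' i = Q j' i)"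
  then have "budgets n m T P (j - 1) = budgets n m T Q (j - 1)"
    by (intro budgets_cong) auto
  moreover have "round_winner n m P j = round_winner n m Q j"
    using A by (intro round_winner_cong) auto
  ultimately show "first_choice_budget_rule n m T P j = first_choice_budget_rule n m T Q j"
    by (simp add: first_choice_budget_rule_def)
qed

section \<open>Deductions and the total budget\<close>

lemma deduct_bounds:
  assumes "\<And>i. 0 \<le> b i" "0 \<le> q"
  shows "0 \<le> deduct is q b i" "deduct is q b i \<le> b i"
  using assms
proof (induction "is" q b rule: deduct.induct)
  case (2 k "is" q b)
  note IH = 2
  { case 1
    have "0 \<le> deduct is (q - min q (b k)) (b(k := b k - min q (b k))) i"
      using 1 by (intro IH(1)) auto
    then show ?case by simp }
  { case 2
    have "deduct is (q - min q (b k)) (b(k := b k - min q (b k))) i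
        \<le> (b(k := b k - min q (b k))) i"
      using 2 by (intro IH(2)) auto
    also have "\<dots> \<le> b i" using 2 by auto
    finally show ?case by simp }
qed simp_all

lemma deduct_outside: "i \<notin> set is \<Longrightarrow> deduct is q b i = b i"
  by (induction "is" q b rule: deduct.induct) auto

text \<open>The listed voters together hold at least \<open>q\<close>, so nothing is outstanding at
  the end of the list.\<close>

lemma sum_deduct:
  assumes "finite A" "set is \<subseteq> A" "distinct is" "q \<le> sum b (set is)" "0 \<le> q" "\<And>i. 0 \<le> b i"
  shows "sum (deduct is q b) A = sum b A - q"
  using assms
proof (induction "is" q b rule: deduct.induct)
  case (2 k "is" q b)
  let ?b = "b(k := b k - min q (b k))"
  have eq: "sum ?b (set is) = sum b (set is)"
    using 2 by (intro sum.cong) auto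
  have k: "k \<in> A" using 2 by simp
  have "sum (deduct is (q - min q (b k)) ?b) A = sum ?b A - (q - min q (b k))"
  proof (rule 2(1))
    \<comment> \<open>Either voter \<open>k\<close> covers \<open>q\<close> and nothing remains, or
      the rest \<open>q - b k\<close> is covered by the tail of the list.\<close>
    have "q \<le> b k + sum b (set is)" "0 \<le> sum b (set is)" using 2 by (auto intro: sum_nonneg)
    then show "q - min q (b k) \<le> sum ?b (set is)" using 2 unfolding eq by linarith
  qed (use 2 in auto)
  also have "sum ?b A = sum b A - min q (b k)"
    using k \<open>finite A\<close> by (simp add: sum.remove[of A k])
  finally show ?case by (simp only: deduct.simps)
qed simp

lemma budgets_nonneg: "0 \<le> budgets n m T P k i"
proof (induction k arbitrary: i)
  case (Suc k)
  then show ?case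
    by (auto simp: Let_def backing_def simp del: deduct.simps intro!: deduct_bounds(1) sum_nonneg)
qed simp

lemma budgets_Suc_le: "budgets n m T P (Suc k) i \<le> budgets n m T P k i"
  by (auto simp: Let_def backing_def budgets_nonneg simp del: deduct.simps
      intro!: deduct_bounds(2) sum_nonneg)

lemma sum_budgets_Suc:
  "sum (budgets n m T P (Suc k)) {1..n} = sum (budgets n m T P k) {1..n} -
     min 1 (backing n P (Suc k) (budgets n m T P k)
       (round_winner n m P (Suc k) (budgets n m T P k)))"
  by (auto simp: Let_def first_voters_def backing_def budgets_nonneg simp del: deduct.simps
      intro!: sum_deduct sum_nonneg)

text \<open>Each voter backs exactly one candidate, her first choice, so the voters are merely
  regrouped.\<close>

lemma sum_backing:
  assumes "profile n m T P" "j \<in> {1..T}"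
  shows "(\<Sum>c\<in>first_choices n m P j. backing n P j b c) = sum b {1..n}"
proof -
  have "(\<Sum>c\<in>first_choices n m P j. backing n P j b c)
      = (\<Sum>c\<in>first_choices n m P j. sum b {i \<in> {1..n}. first_choice P j i = c})"
    by (simp add: backing_def first_voters_def)
  also have "\<dots> = sum b {1..n}"
    using first_choice_in_first_choices[OF assms] by (intro sum.group) auto
  finally show ?thesis .
qed

text \<open>The winner's backing is at least the average over at most \<open>d\<close> first
  choices. The two arguments of \<open>max\<close> are the cases where the winner's backers pay 1
  and where they pay all they have.\<close>

lemma sum_budgets_Suc_le:
  assumes P: "profile n m T P" and d: "at_most_first_choices d n m T P" and k: "k < T"
  shows "sum (budgets n m T P (Suc k)) {1..n} \<le>
    max (sum (budgets n m T P k) {1..n} - 1)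
      ((1 - 1 / real d) * sum (budgets n m T P k) {1..n})"
proof -
  let ?j = "Suc k" and ?b = "budgets n m T P k"
  let ?C = "first_choices n m P ?j" and ?x = "backing n P ?j ?b (round_winner n m P ?j ?b)"
  have j: "?j \<in> {1..T}" using k by simp
  have C: "0 < card ?C" "card ?C \<le> d"
    using first_choices_nonempty[OF P j] d j
    by (auto simp: card_gt_0_iff at_most_first_choices_def)
  have x0: "0 \<le> ?x" by (simp add: backing_def budgets_nonneg sum_nonneg)
  have "sum ?b {1..n} \<le> of_nat (card ?C) * ?x"
    unfolding sum_backing[OF P j, symmetric]
    by (rule sum_bounded_above) (rule round_winner_max[OF P j])
  also have "\<dots> \<le> real d * ?x" using C x0 by (intro mult_right_mono) auto
  finally have "sum ?b {1..n} / real d \<le> ?x" using C by (simp add: field_simps)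
  then show ?thesis
    by (simp only: sum_budgets_Suc) (auto simp: algebra_simps min_def max_def)
qed

section \<open>Decay of the total budget\<close>

lemma geometric_decay:
  fixes f :: "nat \<Rightarrow> real"
  assumes step: "\<And>k. k < i \<Longrightarrow> f (Suc (j + k)) \<le> max (f (j + k) - 1) ((1 - 1 / d) * f (j + k))"
    and "f j \<le> x" "0 \<le> x" "x \<le> d" "1 \<le> d"
  shows "f (j + i) \<le> x * (1 - 1 / d) ^ i"
  using step
proof (induction i)
  case (Suc i)
  have q: "0 \<le> 1 - 1 / d" "1 - 1 / d \<le> 1" using assms by auto
  have IH: "f (j + i) \<le> x * (1 - 1 / d) ^ i" using Suc by simp
  also have "\<dots> \<le> x" using q \<open>0 \<le> x\<close> by (simp add: mult_left_le power_le_one)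
  \<comment> \<open>For a value of at most \<open>d\<close>, subtracting 1 leaves no more than
    removing the fraction \<open>1 / d\<close>, so the second argument of the maximum
    dominates.\<close>
  finally have "f (j + i) - 1 \<le> (1 - 1 / d) * f (j + i)"
    using assms by (simp add: field_simps)
  then have "f (Suc (j + i)) \<le> (1 - 1 / d) * f (j + i)"
    using Suc.prems[of i] by simp
  also have "\<dots> \<le> (1 - 1 / d) * (x * (1 - 1 / d) ^ i)"
    using IH q by (intro mult_left_mono)
  finally show ?case by (simp add: mult_ac)
qed (use assms in simp)

text \<open>For \<open>0 < s < d\<close> the ratio of consecutive values,
  \<open>(s + 1) * (1 - 1 / d) / s\<close>, is at least 1. This handles horizons shorter than
  \<open>d\<close>.\<close>

lemma mult_power_mono:
  fixes d s :: nat
  assumes "s \<le> d" "1 \<le> d"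
  shows "real s * (1 - 1 / real d) ^ s \<le> real d * (1 - 1 / real d) ^ d"
  using assms(1)
proof (induction rule: inc_induct)
  case (step s)
  have "real s * real d \<le> (real s + 1) * (real d - 1)"
    using step by (simp add: algebra_simps)
  then have "real s \<le> real (Suc s) * (1 - 1 / real d)"
    using assms by (simp add: field_simps)
  then have "real s * (1 - 1 / real d) ^ s \<le> real (Suc s) * (1 - 1 / real d) * (1 - 1 / real d) ^ s"
    using assms by (intro mult_right_mono) auto
  then show ?case using step by (simp add: mult_ac)
qed simp

lemma final_value_le:
  fixes f :: "nat \<Rightarrow> real"
  assumes f: "f 0 = real T"
    and step: "\<And>k. k < T \<Longrightarrow> f (Suc k) \<le> max (f k - 1) ((1 - 1 / real d) * f k)"
    and d: "1 \<le> d"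
  shows "f T \<le> real d * (1 - 1 / real d) ^ d"
proof -
  \<comment> \<open>\<open>s\<close> is both the length of the geometric phase and the bound on the
    total at its start; the linear phase takes the first \<open>T - s\<close> rounds.\<close>
  define s where "s = min T d"
  have "k \<le> T - s \<Longrightarrow> f k \<le> real T - real k" for k
  proof (induction k)
    case (Suc k)
    \<comment> \<open>A round in the linear phase exists only if \<open>T > d\<close>, and then
      \<open>s = d\<close>.\<close>
    have kd: "real T - real k \<ge> real d + 1" using Suc by (auto simp: s_def min_def split: if_splits)
    have IH: "f k \<le> real T - real k" using Suc by simp
    have "(1 - 1 / real d) * f k \<le> (1 - 1 / real d) * (real T - real k)"
      using IH d by (intro mult_left_mono) auto
    also have "\<dots> \<le> real T - real k - 1" using kd d by (simp add: field_simps)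
    finally have "(1 - 1 / real d) * f k \<le> real T - real k - 1" .
    moreover have "k < T" using Suc.prems by simp
    ultimately show ?case using step[of k] IH by simp
  qed (use f in simp)
  from this[of "T - s"] have "f (T - s) \<le> real s" by (auto simp: s_def)
  then have "f (T - s + s) \<le> real s * (1 - 1 / real d) ^ s"
    using d by (intro geometric_decay step) (auto simp: s_def)
  also have "\<dots> \<le> real d * (1 - 1 / real d) ^ d"
    using d by (intro mult_power_mono) (auto simp: s_def)
  finally show ?thesis by (simp add: s_def)
qed

section \<open>From unspent budget to representation\<close>

lemma group_spending_le:
  assumes S: "S \<subseteq> {1..n}"
  shows "sum (budgets n m T P 0) S - sum (budgets n m T P k) S
    \<le> real (card {j\<in>{1..k}. \<exists>i\<in>S. first_choice_budget_rule n m T P j = first_choice P j i})"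
proof (induction k)
  case (Suc k)
  let ?b = "budgets n m T P" and ?w = "first_choice_budget_rule n m T P"
  let ?H = "\<lambda>k. {j\<in>{1..k}. \<exists>i\<in>S. ?w j = first_choice P j i}"
  let ?r = "round_winner n m P (Suc k) (?b k)"
  have w: "?w (Suc k) = ?r" by (simp add: first_choice_budget_rule_def)
  show ?case
  proof (cases "\<exists>i\<in>S. ?w (Suc k) = first_choice P (Suc k) i")
    case True
    then have "?H (Suc k) = insert (Suc k) (?H k)" by (auto simp: le_Suc_eq)
    then have H: "card (?H (Suc k)) = Suc (card (?H k))" by simp
    \<comment> \<open>No budget ever grows, so the group's payment is at most the payment of all
      voters.\<close>
    have "(\<Sum>i\<in>S. ?b k i - ?b (Suc k) i) \<le> (\<Sum>i\<in>{1..n}. ?b k i - ?b (Suc k) i)"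
      using S budgets_Suc_le by (intro sum_mono2) (auto simp del: budgets.simps)
    also have "\<dots> \<le> 1" unfolding sum_subtractf sum_budgets_Suc by simp
    finally show ?thesis using Suc H by (simp add: sum_subtractf del: budgets.simps)
  next
    case False
    then have H: "?H (Suc k) = ?H k" by (auto simp: le_Suc_eq)
    have "\<And>i. i \<in> S \<Longrightarrow> i \<notin> first_voters n P (Suc k) ?r"
      using False by (auto simp: w first_voters_def)
    then have "sum (?b (Suc k)) S = sum (?b k) S"
      by (intro sum.cong) (auto simp: Let_def deduct_outside)
    then show ?thesis using Suc by (simp only: H)
  qed
qed simp

text \<open>One factor of the power turns \<open>d\<close> into \<open>d - 1\<close>. The value is
  nonnegative, so \<open>nat\<close> in \<open>Delta\<close> changes nothing.\<close>

lemma Delta_eq: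
  assumes "1 \<le> d"
  shows "int (Delta d) = \<lfloor>real d * (1 - 1 / real d) ^ d\<rfloor>"
proof -
  have "real d * (1 - 1 / real d) ^ d = (real d - 1) * (1 - 1 / real d) ^ (d - 1)"
    using assms by (cases d) (simp_all add: right_diff_distrib)
  moreover have "0 \<le> (real d - 1) * (1 - 1 / real d) ^ (d - 1)" using assms by auto
  ultimately show ?thesis by (simp add: Delta_def)
qed

text \<open>The group starts with \<open>card S * T / n\<close> and keeps at most what all voters
  together keep; the difference bounds its number of paid rounds from below.\<close>

lemma budget_rule_first_choice_rounds:
  assumes P: "profile n m T P" and d: "at_most_first_choices d n m T P" "1 \<le> d"
    and S: "S \<subseteq> {1..n}"
  shows "int (card {j\<in>{1..T}. \<exists>i\<in>S. first_choice_budget_rule n m T P j = first_choice P j i})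
    \<ge> \<lfloor>real (card S) * real T / real n\<rfloor> - int (Delta d)" (is "int ?h \<ge> \<lfloor>?q\<rfloor> - _")
proof -
  let ?b = "budgets n m T P" and ?D = "real d * (1 - 1 / real d) ^ d"
  have "sum (?b T) S \<le> sum (?b T) {1..n}"
    using S budgets_nonneg by (intro sum_mono2) auto
  also have "\<dots> \<le> ?D"
    using sum_budgets_Suc_le[OF P d(1)] P d(2)
    by (intro final_value_le[where f = "\<lambda>k. sum (?b k) {1..n}"])
      (auto simp: profile_def simp del: budgets.simps(2))
  finally have "?q - ?D \<le> real ?h"
    using group_spending_le[OF S, of m T P T] by simp
  then have "of_int \<lfloor>?q\<rfloor> - real ?h \<le> ?D" by linarith
  \<comment> \<open>The left side is an integer, so the bound \<open>?D\<close> may be rounded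
    down.\<close>
  then have "\<lfloor>?q\<rfloor> - int ?h \<le> \<lfloor>?D\<rfloor>" by (simp add: le_floor_iff)
  then show ?thesis using Delta_eq[OF d(2)] by simp
qed

lemma first_choice_in_top_set:
  assumes "profile n m T P" "j \<in> {1..T}" "i \<in> {1..n}" "1 \<le> r"
  shows "first_choice P j i \<in> top_set P j i r"
proof -
  have "P j i \<noteq> []" using assms by (force simp: profile_def permutations_of_set_def)
  with assms(4) show ?thesis
    by (cases "P j i"; cases r) (auto simp: top_set_def first_choice_def)
qed

text \<open>All ranks are at least 1, so a round won by a member's first choice represents the group
  under every rank matrix. Moreover \<open>k \<le> T\<close>, so the demand is at most
  \<open>card S * T / n\<close>.\<close>

lemma budget_rule_all_rank_PJR:
  assumes P: "profile n m T P" and d: "at_most_first_choices d n m T P" "1 \<le> d"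
  shows "all_rank_PJR n m T P (Delta d) (first_choice_budget_rule n m T P)"
  unfolding all_rank_PJR_def
proof (intro allI impI, elim conjE)
  let ?w = "first_choice_budget_rule n m T P"
  fix R S k
  assume R: "rank_matrix n m T R" and "voter_group n S"
    and k: "k = card {j\<in>{1..T}. agrees P R S j}"
  then have S: "S \<subseteq> {1..n}" by (simp add: voter_group_def)
  have "k \<le> card {1..T}" unfolding k by (rule card_mono) auto
  then have "real k * real (card S) / real n \<le> real (card S) * real T / real n"
    by (simp add: divide_right_mono mult.commute[of _ "real (card S)"] mult_left_mono)
  then have "\<lfloor>real k * real (card S) / real n\<rfloor> \<le> \<lfloor>real (card S) * real T / real n\<rfloor>"
    by (rule floor_mono)
  moreover have "card {j\<in>{1..T}. \<exists>i\<in>S. ?w j = first_choice P j i}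
      \<le> card {j\<in>{1..T}. represented P R ?w S j}"
  proof (rule card_mono)
    show "{j\<in>{1..T}. \<exists>i\<in>S. ?w j = first_choice P j i} \<subseteq> {j\<in>{1..T}. represented P R ?w S j}"
    proof clarify
      fix j i assume "j \<in> {1..T}" "i \<in> S" "?w j = first_choice P j i"
      then show "represented P R ?w S j"
        using first_choice_in_top_set[OF P, of j i "R j i"] R S
        by (auto simp: represented_def rank_matrix_def intro!: bexI[of _ i])
    qed
  qed simp
  ultimately show "int (card {j\<in>{1..T}. represented P R ?w S j})
      \<ge> \<lfloor>real k * real (card S) / real n\<rfloor> - int (Delta d)"
    using budget_rule_first_choice_rounds[OF P d S] by linarith
qed


section \<open>The lower bound\<close>

text \<open>\<open>Suc ((w + d - 1) mod d)\<close> is the cyclic predecessor of the candidate \<open>Suc w\<close>.\<close>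

lemma cyclic_prefix_avoiding:
  assumes "a < d" "w < d" "a \<noteq> w"
  defines "r \<equiv> (if a < w then w - a else w + d - a)"
  shows "r \<in> {1..d}" "Suc ((w + d - 1) mod d) \<in> set (take r (rotate a [1..<d+1]))"
    "Suc w \<notin> set (take r (rotate a [1..<d+1]))"
proof -
  \<comment> \<open>\<open>r\<close> is the number of cyclic steps from \<open>a\<close> to
    \<open>w\<close>. Candidates are residues shifted by one, and the ranking starts at
    \<open>Suc a\<close>.\<close>
  show r: "r \<in> {1..d}" using assms by auto
  have nth: "rotate a [1..<d+1] ! k = Suc ((a + k) mod d)" if "k < d" for k
  proof -
    have "length [1..<d+1] = d" by simp
    with that assms(1) show ?thesis by (simp add: nth_rotate nth_upt del: upt_Suc)
  qed
  have "set (take r (rotate a [1..<d+1])) = (!) (rotate a [1..<d+1]) ` {0..<r}"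
    using r by (intro nth_image[symmetric]) simp
  also have "\<dots> = (\<lambda>k. Suc ((a + k) mod d)) ` {0..<r}"
    using r by (intro image_cong refl nth) auto
  finally have set: "set (take r (rotate a [1..<d+1])) = (\<lambda>k. Suc ((a + k) mod d)) ` {0..<r}" .
  \<comment> \<open>The last entry of the prefix lies one cyclic step before
    \<open>Suc w\<close>.\<close>
  have "(a + (r - 1)) mod d = (w + d - 1) mod d"
  proof (cases "a < w")
    case True
    then have "a + (r - 1) = w - 1" "w + d - 1 = w - 1 + d" by (auto simp: r_def)
    then show ?thesis by (simp only: mod_add_self2)
  next
    case False
    then show ?thesis using assms by (simp add: r_def)
  qed
  then show "Suc ((w + d - 1) mod d) \<in> set (take r (rotate a [1..<d+1]))"
    unfolding set using r by (intro image_eqI[of _ _ "r - 1"]) auto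
  \<comment> \<open>Fewer than \<open>r\<close> steps from \<open>a\<close> do not reach
    \<open>w\<close>, whether or not they wrap around.\<close>
  have avoid: "(a + k) mod d \<noteq> w" if "k < r" for k
  proof (cases "a + k < d")
    case True
    then show ?thesis using that assms by (auto split: if_splits)
  next
    case False
    then have "(a + k) mod d = a + k - d" using that assms by (auto simp: le_mod_geq split: if_splits)
    then show ?thesis using False that assms by (auto split: if_splits)
  qed
  show "Suc w \<notin> set (take r (rotate a [1..<d+1]))"
  proof
    assume "Suc w \<in> set (take r (rotate a [1..<d+1]))"
    then obtain k where "k < r" "w = (a + k) mod d" unfolding set by auto
    with avoid show False by blast
  qed
qed

lemma no_smaller_loss:
  assumes d: "d \<ge> 2" and L: "L < Delta d"
  shows "\<exists>n m T P. profile n m T P \<and> at_most_first_choices d n m T P \<and>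
    (\<forall>W. winner_sequence m T W \<longrightarrow> \<not> all_rank_wPJR n m T P L W)"
proof -
  \<comment> \<open>This counts the functions from \<open>d\<close> rounds to \<open>d\<close>
    residues; \<open>g\<close> matches each of them with one voter.\<close>
  define n where "n = d ^ d"
  let ?F = "{1..d} \<rightarrow>\<^sub>E {..<d}"
  have "card {1..n} = card ?F" by (simp add: n_def card_PiE)
  then obtain g where g: "bij_betw g {1..n} ?F"
    using finite_same_card_bij[of "{1..n}" ?F] by (auto simp: finite_PiE)
  have gd: "g i j < d" if "i \<in> {1..n}" "j \<in> {1..d}" for i j
    using PiE_mem[of "g i" "{1..d}" "\<lambda>_. {..<d}" j] bij_betwE[OF g] that by blast
  define P :: rankings where "P = (\<lambda>j i. rotate (g i j) [1..<d+1])"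
  have P: "profile n d d P"
    using d by (simp add: profile_def P_def n_def permutations_of_set_def
        atLeastLessThanSuc_atLeastAtMost del: upt_Suc)
  have "at_most_first_choices d n d d P"
    unfolding at_most_first_choices_def
  proof
    fix j
    have "card (first_choices n d P j) \<le> card {1..d}"
      by (rule card_mono) (auto simp: first_choices_def)
    then show "card (first_choices n d P j) \<le> d" by simp
  qed
  moreover have "\<not> all_rank_wPJR n d d P L W" if W: "winner_sequence d d W" for W
  proof
    assume wPJR: "all_rank_wPJR n d d P L W"
    define w where "w = (\<lambda>j. W j - 1)"
    have w: "W j = Suc (w j)" "w j < d" if "j \<in> {1..d}" for j
    proof -
      have "W j \<in> {1..d}" using W that by (simp add: winner_sequence_def)
      then show "W j = Suc (w j)" "w j < d" by (auto simp: w_def)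
    qed
    \<comment> \<open>These are the functions that miss the winner in every round. As
      \<open>g\<close> is onto, each of them belongs to a voter, so \<open>S\<close> has
      \<open>(d - 1) ^ d\<close> members.\<close>
    let ?G = "PiE {1..d} (\<lambda>j. {..<d} - {w j})"
    define S where "S = {i\<in>{1..n}. g i \<in> ?G}"
    have "?G \<subseteq> g ` {1..n}"
      unfolding bij_betw_imp_surj_on[OF g] by (intro PiE_mono) auto
    moreover have "g ` S = g ` {1..n} \<inter> ?G" unfolding S_def by blast
    ultimately have img: "g ` S = ?G" by (simp only: Int_absorb1)
    have inj: "inj_on g S"
      using bij_betw_imp_inj_on[OF g] by (rule inj_on_subset) (unfold S_def, blast)
    have "card S = card ?G" unfolding img[symmetric] by (rule card_image[OF inj, symmetric])
    also have "\<dots> = (\<Prod>j\<in>{1..d}. card ({..<d} - {w j}))" by (simp add: card_PiE)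
    also have "\<dots> = (\<Prod>j\<in>{1..d}. d - 1)" using w by (intro prod.cong) auto
    finally have card: "card S = (d - 1) ^ d" by simp
    then have "card S \<noteq> 0" using d by simp
    then have S: "voter_group n S" by (auto simp: voter_group_def S_def)
    have a: "g i j < d" "g i j \<noteq> w j" if "i \<in> S" "j \<in> {1..d}" for i j
      using that by (auto simp: S_def PiE_iff)
    \<comment> \<open>A member's rank reaches exactly to the cyclic predecessor of the winner, the
      same candidate for all members. The value 1 for other voters is a default within the range of
      ranks.\<close>
    define R where
      "R = (\<lambda>j i. if i \<in> S then (if g i j < w j then w j - g i j else w j + d - g i j) else 1)"
    have R: "R j i \<in> {1..d}" "Suc ((w j + d - 1) mod d) \<in> top_set P j i (R j i)"
      "W j \<notin> top_set P j i (R j i)" if "i \<in> S" "j \<in> {1..d}" for i j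
      using cyclic_prefix_avoiding[OF a(1)[OF that] w(2)[OF that(2)] a(2)[OF that]] that w(1)
      by (simp_all add: R_def top_set_def P_def del: upt_Suc)
    have "R j i \<in> {1..d}" if "j \<in> {1..d}" for i j
      using R(1)[of i j] that d by (cases "i \<in> S") (simp_all add: R_def)
    then have "rank_matrix n d d R" by (simp add: rank_matrix_def)
    moreover have "\<forall>j\<in>{1..d}. agrees P R S j"
      unfolding agrees_def using R(2) by blast
    ultimately have "int (card {j\<in>{1..d}. represented P R W S j})
        \<ge> \<lfloor>real d * real (card S) / real n\<rfloor> - int L"
      using wPJR S unfolding all_rank_wPJR_def by blast
    moreover have none: "{j\<in>{1..d}. represented P R W S j} = {}"
      unfolding represented_def using R(3) by blast
    moreover have "real d * real (card S) / real n = real d * (1 - 1 / real d) ^ d"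
    proof -
      have "1 - 1 / real d = real (d - 1) / real d" using d by (simp add: field_simps of_nat_diff)
      then show ?thesis by (simp only: card n_def power_divide of_nat_power times_divide_eq_right)
    qed
    \<comment> \<open>The group is represented in 0 rounds, so the axiom would force
      \<open>Delta d \<le> L\<close>.\<close>
    ultimately have "\<lfloor>real d * (1 - 1 / real d) ^ d\<rfloor> - int L \<le> 0"
      by (simp only: card.empty of_nat_0)
    then show False using L d Delta_eq[of d] by simp
  qed
  ultimately show ?thesis using P by blast
qed

lemma no_rule_with_smaller_loss:
  assumes "d \<ge> 2" "L < Delta d" "offline_rule F"
  shows "\<not> (\<forall>n m T P. profile n m T P \<and> at_most_first_choices d n m T P \<longrightarrow>
    all_rank_wPJR n m T P L (F n m T P))"
  using no_smaller_loss[OF assms(1,2)] assms(3) unfolding offline_rule_def by blast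

section \<open>Running times of machine programs\<close>

text \<open>Total correctness with a time bound. \<open>B\<close> is only an upper bound, so costs
  may be rounded up freely.\<close>

definition halts :: "prog \<Rightarrow> store \<Rightarrow> nat \<Rightarrow> (store \<Rightarrow> bool) \<Rightarrow> bool" where
  "halts c s B Q \<longleftrightarrow> (\<exists>t s'. exec c s t s' \<and> t \<le> B \<and> Q s')"

lemma halts_mono: "halts c s B Q \<Longrightarrow> B \<le> B' \<Longrightarrow> (\<And>s'. Q s' \<Longrightarrow> Q' s') \<Longrightarrow> halts c s B' Q'"
  unfolding halts_def using le_trans by blast

lemma halts_Seq:
  assumes "halts c s B Q" "\<And>s'. Q s' \<Longrightarrow> halts c' s' B' Q'"
  shows "halts (Seq c c') s (B + B') Q'"
  using assms unfolding halts_def by (meson add_mono exec.Seq)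

text \<open>\<open>I k\<close> holds after \<open>k\<close> iterations. The bound counts
  \<open>N\<close> successful tests and the final failing one.\<close>

lemma halts_While:
  assumes "I 0 s"
    and "\<And>k s. k < N \<Longrightarrow> I k s \<Longrightarrow> val e s \<noteq> 0 \<and> halts c s B (I (Suc k))"
    and "\<And>s. I N s \<Longrightarrow> val e s = 0"
  shows "halts (While e c) s (N * (1 + expr_cost e + B) + (1 + expr_cost e)) (I N)"
proof -
  \<comment> \<open>Here \<open>k\<close> counts the iterations still to come.\<close>
  have "I (N - k) s \<Longrightarrow> k \<le> N \<Longrightarrow>
      halts (While e c) s (k * (1 + expr_cost e + B) + (1 + expr_cost e)) (I N)" for k s
  proof (induction k arbitrary: s)
    case 0
    then show ?case using assms(3) exec.WhileFalse by (force simp: halts_def)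
  next
    case (Suc k)
    have "val e s \<noteq> 0 \<and> halts c s B (I (Suc (N - Suc k)))"
      using Suc.prems by (intro assms(2)) auto
    moreover have "Suc (N - Suc k) = N - k" using Suc.prems by simp
    ultimately obtain t s' where *: "val e s \<noteq> 0" "exec c s t s'" "t \<le> B" "I (N - k) s'"
      by (auto simp: halts_def)
    then obtain t' s'' where "exec (While e c) s' t' s''" "I N s''"
      "t' \<le> k * (1 + expr_cost e + B) + (1 + expr_cost e)"
      using Suc.IH[of s'] Suc.prems by (auto simp: halts_def)
    with * exec.WhileTrue[of e s c t s' t' s''] show ?case
      unfolding halts_def by (intro exI[of _ "1 + expr_cost e + t + t'"] exI[of _ s'']) auto
  qed
  from this[of N s] assms(1) show ?thesis by simp
qed

section \<open>Programs without loops\<close>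

primrec loop_free :: "prog \<Rightarrow> bool" where
  "loop_free Skip = True"
| "loop_free (Assign a e f) = True"
| "loop_free (Seq c c') = (loop_free c \<and> loop_free c')"
| "loop_free (Cond e c c') = (loop_free c \<and> loop_free c')"
| "loop_free (While e c) = False"

text \<open>A functional semantics that lets the simplifier run loop-free code. The value at
  \<open>While\<close> is a default.\<close>

primrec effect :: "prog \<Rightarrow> store \<Rightarrow> store" where
  "effect Skip s = s"
| "effect (Assign a e f) s = s(a := (s a)(val e s := val f s))"
| "effect (Seq c c') s = effect c' (effect c s)"
| "effect (Cond e c c') s = (if val e s \<noteq> 0 then effect c s else effect c' s)"
| "effect (While e c) s = s"

primrec max_cost :: "prog \<Rightarrow> nat" where
  "max_cost Skip = 1"
| "max_cost (Assign a e f) = 1 + expr_cost e + expr_cost f"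
| "max_cost (Seq c c') = max_cost c + max_cost c'"
| "max_cost (Cond e c c') = 1 + expr_cost e + max (max_cost c) (max_cost c')"
| "max_cost (While e c) = 0"

lemma loop_free_exec: "loop_free c \<Longrightarrow> \<exists>t \<le> max_cost c. exec c s t (effect c s)"
proof (induction c arbitrary: s)
  case (Seq c c')
  then show ?case
    by (metis add_mono exec.Seq loop_free.simps(3) max_cost.simps(3) effect.simps(3))
next
  case (Cond e c c')
  obtain t where t: "t \<le> max_cost c" "exec c s t (effect c s)" using Cond by auto
  obtain t' where t': "t' \<le> max_cost c'" "exec c' s t' (effect c' s)" using Cond by auto
  show ?case
  proof (cases "val e s = 0")
    case True
    then show ?thesis
      using exec.CondFalse[OF True t'(2), of c] t'(1) by (intro exI[of _ "1 + expr_cost e + t'"]) auto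
  next
    case False
    then show ?thesis
      using exec.CondTrue[OF False t(2), of c'] t(1) by (intro exI[of _ "1 + expr_cost e + t"]) auto
  qed
next
  case Skip
  show ?case using exec.Skip by (intro exI[of _ 1]) auto
next
  case (Assign a e f)
  show ?case using exec.Assign[of a e f s] by (metis effect.simps(2) max_cost.simps(2) order_refl)
qed simp

lemma halts_loop_free: "loop_free c \<Longrightarrow> Q (effect c s) \<Longrightarrow> halts c s (max_cost c) Q"
  using loop_free_exec unfolding halts_def by blast

section \<open>Counting loops\<close>

abbreviation var :: "nat \<Rightarrow> expr" where "var a \<equiv> Cell a (Const 0)"

abbreviation set_var :: "nat \<Rightarrow> expr \<Rightarrow> prog" where "set_var a e \<equiv> Assign a (Const 0) e"

abbreviation incr :: "nat \<Rightarrow> prog" where "incr a \<equiv> set_var a (Add (var a) (Const 1))"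

text \<open>Truncated subtraction makes the test mean that the counter is below \<open>e\<close>.
  Incrementing before the body gives it the values 1 to \<open>N\<close>, as for voters, candidates
  and rounds.\<close>

definition for_loop :: "nat \<Rightarrow> expr \<Rightarrow> prog \<Rightarrow> prog" where
  "for_loop a e c = Seq (set_var a (Const 0)) (While (Sub e (var a)) (Seq (incr a) c))"

text \<open>The reset takes 3 steps, each test \<open>4 + expr_cost e\<close> and each increment 6;
  there are \<open>N + 1\<close> tests.\<close>

definition for_cost :: "nat \<Rightarrow> expr \<Rightarrow> nat \<Rightarrow> nat" where
  "for_cost N e B = 3 + (N * (10 + expr_cost e + B) + (4 + expr_cost e))"

lemma halts_for_loop:
  assumes init: "I 0 (s(a := (s a)(0 := 0)))"
    and e: "\<And>k s. k \<le> N \<Longrightarrow> I k s \<Longrightarrow> val e s = N"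
    and body: "\<And>k s. k < N \<Longrightarrow> I k s \<Longrightarrow> s a 0 = k \<Longrightarrow>
      halts c (s(a := (s a)(0 := Suc k))) B (\<lambda>s'. I (Suc k) s' \<and> s' a 0 = Suc k)"
  shows "halts (for_loop a e c) s (for_cost N e B) (I N)"
proof -
  have incr: "halts (incr a) s 6 (\<lambda>s'. s' = s(a := (s a)(0 := Suc (s a 0))))" for s
    using halts_loop_free[of "incr a"] by (simp add: eval_nat_numeral)
  have init_loop: "halts (set_var a (Const 0)) s 3 (\<lambda>s'. s' = s(a := (s a)(0 := 0)))"
    using halts_loop_free[of "set_var a (Const 0)"] by (simp add: eval_nat_numeral)
  have while_loop: "halts (While (Sub e (var a)) (Seq (incr a) c)) (s(a := (s a)(0 := 0)))
      (N * (1 + expr_cost (Sub e (var a)) + (6 + B)) + (1 + expr_cost (Sub e (var a))))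
      (\<lambda>s'. I N s' \<and> s' a 0 = N)"
  proof (rule halts_While[where I = "\<lambda>k s. I k s \<and> s a 0 = k"], goal_cases)
    case (2 k s)
    then have "halts (Seq (incr a) c) s (6 + B) (\<lambda>s'. I (Suc k) s' \<and> s' a 0 = Suc k)"
      by (intro halts_Seq[OF incr]) (auto intro: body)
    then show ?case using 2 e[of k s] by simp
  next
    case (3 s)
    then show ?case using e[of N s] by simp
  qed (use init in simp)
  have "halts (for_loop a e c) s
      (3 + (N * (1 + expr_cost (Sub e (var a)) + (6 + B)) + (1 + expr_cost (Sub e (var a)))))
      (\<lambda>s'. I N s' \<and> s' a 0 = N)"
    unfolding for_loop_def by (rule halts_Seq[OF init_loop]) (simp only: while_loop)
  then show ?thesis by (rule halts_mono) (simp_all add: for_cost_def)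
qed

lemma halts_for_loop_free:
  assumes "loop_free c" "I 0 (s(a := (s a)(0 := 0)))"
    and "\<And>k s. k \<le> N \<Longrightarrow> I k s \<Longrightarrow> val e s = N"
    and "\<And>k s. k < N \<Longrightarrow> I k s \<Longrightarrow> s a 0 = k \<Longrightarrow>
      I (Suc k) (effect c (s(a := (s a)(0 := Suc k)))) \<and>
      effect c (s(a := (s a)(0 := Suc k))) a 0 = Suc k"
  shows "halts (for_loop a e c) s (for_cost N e (max_cost c)) (I N)"
proof (rule halts_for_loop)
  fix k s assume "k < N" "I k s" "s a 0 = k"
  then show "halts c (s(a := (s a)(0 := Suc k))) (max_cost c) (\<lambda>s'. I (Suc k) s' \<and> s' a 0 = Suc k)"
    by (intro halts_loop_free assms)
qed (fact assms)+


section \<open>A program for the budget rule\<close>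

text \<open>
  Budgets are stored as multiples of \<open>1 / n\<close>, so that they start at \<open>T\<close>, a round costs \<open>n\<close>, and they
  stay natural numbers.  The arrays are: 0 input, 2 budgets, 3 backing of each candidate,
  4 indicator of the first choices, 5 first choice of each voter, 6 round, 7 inner counter,
  8 input position, 9 and 10 best candidate and its key, 11 amount to deduct, 12 temporary.
\<close>

definition init_prog :: prog where
  "init_prog = for_loop 7 (var 0) (Assign 2 (var 7) (Cell 0 (Const 2)))"

definition clear_prog :: prog where
  "clear_prog = for_loop 7 (Cell 0 (Const 1))
     (Seq (Assign 3 (var 7) (Const 0)) (Assign 4 (var 7) (Const 0)))"

definition tally_prog :: prog where
  "tally_prog = for_loop 7 (var 0)
     (Seq (Assign 5 (var 7) (Cell 0 (var 8)))
     (Seq (Assign 3 (Cell 5 (var 7)) (Add (Cell 3 (Cell 5 (var 7))) (Cell 2 (var 7))))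
     (Seq (Assign 4 (Cell 5 (var 7)) (Const 1))
       (set_var 8 (Add (var 8) (Cell 0 (Const 1)))))))"

text \<open>Adding the indicator to the backing ranks first choices without backing above the
  other candidates.\<close>

definition select_prog :: prog where
  "select_prog = Seq (set_var 9 (Const 0)) (Seq (set_var 10 (Const 0))
     (for_loop 7 (Cell 0 (Const 1))
       (Cond (Sub (Add (Cell 3 (var 7)) (Cell 4 (var 7))) (var 10))
         (Seq (set_var 9 (var 7)) (set_var 10 (Add (Cell 3 (var 7)) (Cell 4 (var 7)))))
         Skip)))"

text \<open>Since subtraction is truncated, \<open>x - (x - y)\<close> is \<open>min x y\<close>, and \<open>b - q\<close> is \<open>b - min q b\<close>.\<close>

definition deduct_prog :: prog where
  "deduct_prog = Seq (set_var 11 (Sub (var 0) (Sub (var 0) (Cell 3 (var 9)))))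
     (for_loop 7 (var 0)
       (Cond (Add (Sub (Cell 5 (var 7)) (var 9)) (Sub (var 9) (Cell 5 (var 7))))
         Skip
         (Seq (set_var 12 (Sub (var 11) (Cell 2 (var 7))))
         (Seq (Assign 2 (var 7) (Sub (Cell 2 (var 7)) (var 11)))
           (set_var 11 (var 12))))))"

definition round_prog :: prog where
  "round_prog = Seq clear_prog (Seq tally_prog (Seq select_prog
     (Seq (Assign 1 (var 6) (var 9)) deduct_prog)))"

definition rule_prog :: prog where
  "rule_prog = Seq init_prog (Seq (set_var 8 (Const 3)) (for_loop 6 (Cell 0 (Const 2)) round_prog))"

text \<open>The frame condition that carries facts about untouched arrays through a program.\<close>

definition same_except :: "nat set \<Rightarrow> store \<Rightarrow> store \<Rightarrow> bool" where
  "same_except A s s' \<longleftrightarrow> (\<forall>a. a \<notin> A \<longrightarrow> s' a = s a)"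

section \<open>Effect and cost of the subprograms\<close>

lemma init_prog_halts:
  assumes "s 0 0 = n"
  shows "halts init_prog s (for_cost n (var 0) 8)
    (\<lambda>s'. same_except {2, 7} s s' \<and> (\<forall>i\<in>{1..n}. s' 2 i = s 0 2))"
proof -
  have "halts init_prog s (for_cost n (var 0) (max_cost (Assign 2 (var 7) (Cell 0 (Const 2)))))
    (\<lambda>s'. same_except {2, 7} s s' \<and> (\<forall>i\<in>{1..n}. s' 2 i = s 0 2))"
    unfolding init_prog_def
    by (rule halts_for_loop_free[where I = "\<lambda>k s'. same_except {2, 7} s s' \<and>
          (\<forall>i\<in>{1..k}. s' 2 i = s 0 2)"])
      (auto simp: same_except_def assms le_Suc_eq)
  \<comment> \<open>The 8 is the cost of the loop body rounded up; the body costs in the other loops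
    are rounded up likewise.\<close>
  then show ?thesis by (rule halts_mono) (auto simp: for_cost_def)
qed

lemma clear_prog_halts:
  assumes "s 0 1 = m"
  shows "halts clear_prog s (for_cost m (Cell 0 (Const 1)) 16)
    (\<lambda>s'. same_except {3, 4, 7} s s' \<and> (\<forall>c\<in>{1..m}. s' 3 c = 0 \<and> s' 4 c = 0))"
proof (rule halts_mono)
  show "halts clear_prog s (for_cost m (Cell 0 (Const 1))
      (max_cost (Seq (Assign 3 (var 7) (Const 0)) (Assign 4 (var 7) (Const 0)))))
    (\<lambda>s'. same_except {3, 4, 7} s s' \<and> (\<forall>c\<in>{1..m}. s' 3 c = 0 \<and> s' 4 c = 0))"
    unfolding clear_prog_def
    by (rule halts_for_loop_free[where I = "\<lambda>k s'. same_except {3, 4, 7} s s' \<and>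
          (\<forall>c\<in>{1..k}. s' 3 c = 0 \<and> s' 4 c = 0)"])
      (use assms in \<open>auto simp: same_except_def le_Suc_eq\<close>)
qed (auto simp: for_cost_def)

text \<open>Cell 0 of array 8 points at the first entry of the current voter's ranking. It moves by
  \<open>m\<close> per voter and so ends at the block of the next round.\<close>

lemma tally_prog_halts:
  assumes n: "s 0 0 = n" and m: "s 0 1 = m"
    and f: "\<And>i. i \<in> {1..n} \<Longrightarrow> f i = s 0 (s 8 0 + (i - 1) * m)"
    and zero: "\<And>i. i \<in> {1..n} \<Longrightarrow> s 3 (f i) = 0 \<and> s 4 (f i) = 0"
  shows "halts tally_prog s (for_cost n (var 0) 50)
    (\<lambda>s'. same_except {3, 4, 5, 7, 8} s s' \<and> s' 8 0 = s 8 0 + n * m \<and>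
       (\<forall>i\<in>{1..n}. s' 5 i = f i) \<and>
       (\<forall>c. s' 3 c = s 3 c + (\<Sum>i\<in>{i\<in>{1..n}. f i = c}. s 2 i)) \<and>
       (\<forall>c. s' 4 c = (if c \<in> f ` {1..n} then 1 else s 4 c)))"
proof (rule halts_mono)
  let ?c = "Seq (Assign 5 (var 7) (Cell 0 (var 8)))
     (Seq (Assign 3 (Cell 5 (var 7)) (Add (Cell 3 (Cell 5 (var 7))) (Cell 2 (var 7))))
     (Seq (Assign 4 (Cell 5 (var 7)) (Const 1))
       (set_var 8 (Add (var 8) (Cell 0 (Const 1))))))"
  let ?I = "\<lambda>k s'. same_except {3, 4, 5, 7, 8} s s' \<and> s' 8 0 = s 8 0 + k * m \<and>
       (\<forall>i\<in>{1..k}. s' 5 i = f i) \<and>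
       (\<forall>c. s' 3 c = s 3 c + (\<Sum>i\<in>{i\<in>{1..k}. f i = c}. s 2 i)) \<and>
       (\<forall>c. s' 4 c = (if c \<in> f ` {1..k} then 1 else s 4 c))"
  have set: "{i\<in>{1..Suc k}. f i = c} =
      (if f (Suc k) = c then insert (Suc k) {i\<in>{1..k}. f i = c} else {i\<in>{1..k}. f i = c})" for k c
    by (auto simp: le_Suc_eq)
  show "halts tally_prog s (for_cost n (var 0) (max_cost ?c)) (?I n)"
    unfolding tally_prog_def
  proof (rule halts_for_loop_free[where I = ?I])
    fix k s' assume k: "k < n" and I: "?I k s'" and s7: "s' 7 0 = k"
    have eq: "s' 0 = s 0" "s' 2 = s 2" using I by (auto simp: same_except_def)
    have fk: "s 0 (s 8 0 + k * m) = f (Suc k)" using k by (simp add: f)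
    define t where "t = effect ?c (s'(7 := (s' 7)(0 := Suc k)))"
    have t: "t 5 = (s' 5)(Suc k := f (Suc k))" "t 4 = (s' 4)(f (Suc k) := 1)"
      "t 3 = (s' 3)(f (Suc k) := s' 3 (f (Suc k)) + s 2 (Suc k))"
      "t 8 0 = s 8 0 + Suc k * m" "t 7 0 = Suc k"
      using I fk m unfolding t_def by (simp_all add: eq)
    have "same_except {3, 4, 5, 7, 8} s t"
      using I unfolding t_def by (simp add: same_except_def)
    moreover have "\<forall>i\<in>{1..Suc k}. t 5 i = f i" using I by (auto simp: t le_Suc_eq)
    moreover have "\<forall>c. t 3 c = s 3 c + (\<Sum>i\<in>{i\<in>{1..Suc k}. f i = c}. s 2 i)"
      using I unfolding t set by simp
    moreover have "\<forall>c. t 4 c = (if c \<in> f ` {1..Suc k} then 1 else s 4 c)"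
      using I by (auto simp: t atLeastAtMostSuc_conv)
    ultimately show "?I (Suc k) (effect ?c (s'(7 := (s' 7)(0 := Suc k)))) \<and>
        effect ?c (s'(7 := (s' 7)(0 := Suc k))) 7 0 = Suc k"
      unfolding t_def[symmetric] using t by blast
  qed (auto simp: same_except_def n)
qed (auto simp: for_cost_def)

text \<open>A scan that replaces its candidate only for a strictly larger key ends at the least
  maximiser, as the tie-breaking demands.\<close>

lemma select_prog_halts:
  assumes m: "s 0 1 = m" and pos: "\<exists>c\<in>{1..m}. s 3 c + s 4 c > 0"
  shows "halts select_prog s (6 + for_cost m (Cell 0 (Const 1)) 30)
    (\<lambda>s'. same_except {7, 9, 10} s s' \<and> s' 9 0 \<in> {1..m} \<and>
       (\<forall>c\<in>{1..m}. s 3 c + s 4 c \<le> s 3 (s' 9 0) + s 4 (s' 9 0)) \<and>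
       (\<forall>c\<in>{1..<s' 9 0}. s 3 c + s 4 c < s 3 (s' 9 0) + s 4 (s' 9 0)))"
proof -
  define key where "key = (\<lambda>c. s 3 c + s 4 c)"
  let ?c = "Cond (Sub (Add (Cell 3 (var 7)) (Cell 4 (var 7))) (var 10))
         (Seq (set_var 9 (var 7)) (set_var 10 (Add (Cell 3 (var 7)) (Cell 4 (var 7)))))
         Skip"
  \<comment> \<open>Index 0 stands for no candidate yet, with key 0; \<open>pos\<close> excludes it
    at the end.\<close>
  let ?I = "\<lambda>k s'. same_except {7, 9, 10} s s' \<and> s' 9 0 \<le> k \<and>
    s' 10 0 = (if s' 9 0 = 0 then 0 else key (s' 9 0)) \<and>
    (\<forall>c\<in>{1..k}. key c \<le> s' 10 0) \<and> (\<forall>c\<in>{1..<s' 9 0}. key c < s' 10 0)"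
  have loop: "halts (for_loop 7 (Cell 0 (Const 1)) ?c) s' (for_cost m (Cell 0 (Const 1)) (max_cost ?c)) (?I m)"
    if "s' = s(9 := (s 9)(0 := 0), 10 := (s 10)(0 := 0))" for s'
  proof (rule halts_for_loop_free[where I = ?I])
    fix k s' assume k: "k < m" and I: "?I k s'" and s7: "s' 7 0 = k"
    have eq: "s' 0 = s 0" "s' 3 = s 3" "s' 4 = s 4" using I by (auto simp: same_except_def)
    define t where "t = effect ?c (s'(7 := (s' 7)(0 := Suc k)))"
    have t: "t 9 0 = (if key (Suc k) > s' 10 0 then Suc k else s' 9 0)"
      "t 10 0 = (if key (Suc k) > s' 10 0 then key (Suc k) else s' 10 0)" "t 7 0 = Suc k"
      unfolding t_def by (simp_all add: eq key_def)
    have "same_except {7, 9, 10} s t"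
      using I unfolding t_def by (simp add: same_except_def)
    moreover have "t 9 0 \<le> Suc k" "t 10 0 = (if t 9 0 = 0 then 0 else key (t 9 0))"
      using I by (auto simp: t)
    moreover have "\<forall>c\<in>{1..Suc k}. key c \<le> t 10 0"
      using I by (force simp: t le_Suc_eq)
    moreover have "key c < t 10 0" if c: "c \<in> {1..<t 9 0}" for c
    proof (cases "s' 10 0 < key (Suc k)")
      case True
      with c have "c \<in> {1..k}" by (auto simp: t)
      then have "key c \<le> s' 10 0" using I by blast
      then show ?thesis using True by (simp add: t)
    next
      case False
      then show ?thesis using I c by (auto simp: t)
    qed
    ultimately show "?I (Suc k) (effect ?c (s'(7 := (s' 7)(0 := Suc k)))) \<and>
        effect ?c (s'(7 := (s' 7)(0 := Suc k))) 7 0 = Suc k"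
      unfolding t_def[symmetric] using t by blast
  qed (use m that in \<open>auto simp: same_except_def\<close>)
  have "halts select_prog s (max_cost (set_var 9 (Const 0)) + (max_cost (set_var 10 (Const 0)) +
      for_cost m (Cell 0 (Const 1)) (max_cost ?c))) (?I m)"
    unfolding select_prog_def by (intro halts_Seq[OF halts_loop_free] loop) auto
  then show ?thesis
  proof (rule halts_mono)
    fix s' assume I: "?I m s'"
    obtain c where "c \<in> {1..m}" "key c > 0" using pos by (auto simp: key_def)
    moreover from this I have "key c \<le> s' 10 0" by blast
    ultimately have "s' 9 0 \<noteq> 0" using I by (cases "s' 9 0 = 0") auto
    with I show "same_except {7, 9, 10} s s' \<and> s' 9 0 \<in> {1..m} \<and>
       (\<forall>c\<in>{1..m}. s 3 c + s 4 c \<le> s 3 (s' 9 0) + s 4 (s' 9 0)) \<and>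
       (\<forall>c\<in>{1..<s' 9 0}. s 3 c + s 4 c < s 3 (s' 9 0) + s 4 (s' 9 0))"
      by (auto simp: key_def)
  qed (auto simp: for_cost_def)
qed

text \<open>One step of \<open>deduct\<close> in truncated arithmetic, carrying the outstanding
  amount. Folding it allows voters to be appended at the end of the list, in the order of the
  loop.\<close>

definition take_from :: "nat \<Rightarrow> nat \<times> (nat \<Rightarrow> nat) \<Rightarrow> nat \<times> (nat \<Rightarrow> nat)" where
  "take_from i = (\<lambda>(q, b). (q - b i, b(i := b i - q)))"

lemma deduct_prog_halts:
  assumes n: "s 0 0 = n"
  shows "halts deduct_prog s (20 + for_cost n (var 0) 40)
    (\<lambda>s'. same_except {2, 7, 11, 12} s s' \<and>
       s' 2 = snd (fold take_from (filter (\<lambda>i. s 5 i = s 9 0) [1..<n+1])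
         (min n (s 3 (s 9 0)), s 2)))"
proof -
  define q where "q = min n (s 3 (s 9 0))"
  let ?xs = "\<lambda>k. filter (\<lambda>i. s 5 i = s 9 0) [1..<k+1]"
  \<comment> \<open>The two truncated differences sum to 0 exactly at equality, so voters who do not
    back the winner are skipped. Array 12 keeps the new outstanding amount while the old one is
    still needed.\<close>
  let ?c = "Cond (Add (Sub (Cell 5 (var 7)) (var 9)) (Sub (var 9) (Cell 5 (var 7))))
         Skip
         (Seq (set_var 12 (Sub (var 11) (Cell 2 (var 7))))
         (Seq (Assign 2 (var 7) (Sub (Cell 2 (var 7)) (var 11)))
           (set_var 11 (var 12))))"
  let ?I = "\<lambda>k s'. same_except {2, 7, 11, 12} s s' \<and>
    (s' 11 0, s' 2) = fold take_from (?xs k) (q, s 2)"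
  have loop: "halts (for_loop 7 (var 0) ?c) s' (for_cost n (var 0) (max_cost ?c)) (?I n)"
    if "s' = s(11 := (s 11)(0 := q))" for s'
  proof (rule halts_for_loop_free[where I = ?I])
    fix k s' assume k: "k < n" and I: "?I k s'" and s7: "s' 7 0 = k"
    have eq: "s' 0 = s 0" "s' 5 = s 5" "s' 9 = s 9" using I by (auto simp: same_except_def)
    define t where "t = effect ?c (s'(7 := (s' 7)(0 := Suc k)))"
    have t: "(t 11 0, t 2) = (if s 5 (Suc k) = s 9 0 then take_from (Suc k) (s' 11 0, s' 2)
        else (s' 11 0, s' 2))" "t 7 0 = Suc k"
      unfolding t_def by (auto simp: eq take_from_def)
    have "same_except {2, 7, 11, 12} s t"
      using I unfolding t_def by (simp add: same_except_def)
    moreover have "(t 11 0, t 2) = fold take_from (?xs (Suc k)) (q, s 2)"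
      using I unfolding t(1) by simp
    ultimately show "?I (Suc k) (effect ?c (s'(7 := (s' 7)(0 := Suc k)))) \<and>
        effect ?c (s'(7 := (s' 7)(0 := Suc k))) 7 0 = Suc k"
      unfolding t_def[symmetric] using t by blast
  qed (use n that in \<open>auto simp: same_except_def\<close>)
  have q: "val (Sub (var 0) (Sub (var 0) (Cell 3 (var 9)))) s = q" using n by (auto simp: q_def)
  have "halts deduct_prog s (max_cost (set_var 11 (Sub (var 0) (Sub (var 0) (Cell 3 (var 9))))) +
      for_cost n (var 0) (max_cost ?c)) (?I n)"
    unfolding deduct_prog_def using q by (intro halts_Seq[OF halts_loop_free] loop) auto
  then show ?thesis
    by (rule halts_mono) (auto simp: for_cost_def q_def dest: arg_cong[where f = snd])
qed

section \<open>Layout of the input\<close>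

lemma length_concat_uniform: "\<forall>xs\<in>set xss. length xs = l \<Longrightarrow> length (concat xss) = length xss * l"
  by (induction xss) auto

lemma nth_concat_uniform:
  "\<forall>xs\<in>set xss. length xs = l \<Longrightarrow> k < length xss \<Longrightarrow> r < l \<Longrightarrow>
    concat xss ! (k * l + r) = xss ! k ! r"
proof (induction xss arbitrary: k)
  case (Cons xs xss)
  then show ?case by (cases k) (auto simp: nth_append add.assoc)
qed simp

lemma length_ranking:
  "profile n m T P \<Longrightarrow> j \<in> {1..T} \<Longrightarrow> i \<in> {1..n} \<Longrightarrow> length (P j i) = m"
  using length_finite_permutations_of_set[of "P j i" "{1..m}"] by (auto simp: profile_def)

lemma length_round_encoding:
  assumes "profile n m T P" "j \<in> {1..T}"
  shows "length (concat (map (P j) [1..<n+1])) = n * m"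
  using length_concat_uniform[of "map (P j) [1..<n+1]" m] length_ranking[OF assms] by auto

lemma length_encode:
  assumes "profile n m T P"
  shows "length (encode n m T P) = 3 + T * (n * m)"
  using length_concat_uniform[of "map (\<lambda>j. concat (map (P j) [1..<n+1])) [1..<T+1]" "n * m"]
    length_round_encoding[OF assms] by (auto simp: encode_def)

lemma initial_store_parameters:
  "initial_store (encode n m T P) 0 0 = n" "initial_store (encode n m T P) 0 1 = m"
  "initial_store (encode n m T P) 0 2 = T"
  by (simp_all add: initial_store_def encode_def)

text \<open>The header has 3 entries, a round \<open>n * m\<close> and a ranking \<open>m\<close>;
  each ranking begins with the first choice. \<open>k\<close> and \<open>i\<close> count from
  0.\<close>

lemma initial_store_first_choice:
  assumes P: "profile n m T P" and k: "k < T" and i: "i < n"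
  shows "initial_store (encode n m T P) 0 (3 + k * (n * m) + i * m) = first_choice P (Suc k) (Suc i)"
proof -
  let ?xss = "map (\<lambda>j. concat (map (P j) [1..<n+1])) [1..<T+1]"
  have m: "m \<ge> 1" using P by (simp add: profile_def)
  have im: "i * m < n * m" using i m by simp
  have "k * (n * m) + i * m < Suc k * (n * m)" using im by simp
  also have "\<dots> \<le> T * (n * m)" using k by (intro mult_right_mono) auto
  finally have len: "3 + k * (n * m) + i * m < length (encode n m T P)"
    by (simp add: length_encode[OF P])
  have "encode n m T P ! (3 + k * (n * m) + i * m) = concat ?xss ! (k * (n * m) + i * m)"
    by (simp add: encode_def numeral_3_eq_3 del: upt_Suc)
  also have "\<dots> = concat (map (P (Suc k)) [1..<n+1]) ! (i * m + 0)"
    using nth_concat_uniform[of ?xss "n * m" k "i * m"] length_round_encoding[OF P] im k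
    by (auto simp del: upt_Suc)
  also have "\<dots> = P (Suc k) (Suc i) ! 0"
    using nth_concat_uniform[of "map (P (Suc k)) [1..<n+1]" m i 0] length_ranking[OF P] m i k
    by (auto simp del: upt_Suc)
  also have "\<dots> = first_choice P (Suc k) (Suc i)"
    using length_ranking[OF P, of "Suc k" "Suc i"] k i m
    by (subst hd_conv_nth[symmetric]) (auto simp: first_choice_def)
  finally show ?thesis using len by (simp add: initial_store_def)
qed

section \<open>Agreement of the program with the rule\<close>

lemma round_winner_eqI:
  assumes "c \<in> first_choices n m P j"
    and "\<And>c'. c' \<in> first_choices n m P j \<Longrightarrow> backing n P j b c' \<le> backing n P j b c"
    and "\<And>c'. c' \<in> first_choices n m P j \<Longrightarrow> c' < c \<Longrightarrow> backing n P j b c' < backing n P j b c"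
  shows "round_winner n m P j b = c"
  unfolding round_winner_def
proof (rule Least_equality)
  fix c' assume "c' \<in> first_choices n m P j \<and>
    (\<forall>c''\<in>first_choices n m P j. backing n P j b c'' \<le> backing n P j b c')"
  then show "c \<le> c'" using assms(1) assms(3)[of c'] by (meson not_less)
qed (use assms in auto)

text \<open>Scaling by the positive number \<open>n\<close> preserves comparisons, so both
  computations take the same branch of \<open>min\<close> at each voter. The set \<open>A\<close>
  confines the scaling relation to cells of actual voters.\<close>

lemma fold_take_from:
  assumes "\<And>i. i \<in> A \<Longrightarrow> real (\<beta> i) = real n * b i" "real q = real n * q'" "set is \<subseteq> A" "n \<ge> 1"
  shows "i \<in> A \<Longrightarrow> real (snd (fold take_from is (q, \<beta>)) i) = real n * deduct is q' b i"
  using assms(1-3)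
proof (induction "is" arbitrary: q \<beta> q' b)
  case (Cons k ks)
  have k: "real (\<beta> k) = real n * b k" using Cons.prems(2,4) by simp
  have n: "real n > 0" using \<open>n \<ge> 1\<close> by simp
  have "real q \<le> real (\<beta> k) \<longleftrightarrow> q' \<le> b k" unfolding k Cons.prems(3) using n by simp
  then have le: "q \<le> \<beta> k \<longleftrightarrow> q' \<le> b k" by simp
  have q: "real (q - \<beta> k) = real n * (q' - min q' (b k))"
    and b: "real (\<beta> k - q) = real n * (b k - min q' (b k))"
    using k Cons.prems(3) le
    by (cases "q' \<le> b k"; simp add: of_nat_diff right_diff_distrib min_def)+
  have "real (snd (fold take_from ks (q - \<beta> k, \<beta>(k := \<beta> k - q))) i)
      = real n * deduct ks (q' - min q' (b k)) (b(k := b k - min q' (b k))) i"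
  proof (rule Cons.IH[OF Cons.prems(1) _ q])
    fix i assume "i \<in> A"
    then show "real ((\<beta>(k := \<beta> k - q)) i) = real n * (b(k := b k - min q' (b k))) i"
      using b Cons.prems(2) by simp
  qed (use Cons.prems(4) in simp)
  moreover have "take_from k (q, \<beta>) = (q - \<beta> k, \<beta>(k := \<beta> k - q))" by (simp add: take_from_def)
  ultimately show ?case by simp
qed simp

lemma sorted_list_of_first_voters:
  "sorted_list_of_set (first_voters n P j c) = filter (\<lambda>i. first_choice P j i = c) [1..<n+1]"
proof -
  have "first_voters n P j c = set (filter (\<lambda>i. first_choice P j i = c) [1..<n+1])"
    by (auto simp: first_voters_def)
  then show ?thesis
    by (simp add: sorted_list_of_set.idem_if_sorted_distinct sorted_wrt_filter del: upt_Suc set_filter)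
qed

text \<open>The state after \<open>k\<close> rounds: the input position is at the block of round
  \<open>k + 1\<close>, and array 2 holds budgets in units of \<open>1 / n\<close>.\<close>

definition round_invariant :: "nat \<Rightarrow> nat \<Rightarrow> nat \<Rightarrow> rankings \<Rightarrow> nat \<Rightarrow> store \<Rightarrow> bool" where
  "round_invariant n m T P k s \<longleftrightarrow>
     s 0 = initial_store (encode n m T P) 0 \<and> s 8 0 = 3 + k * (n * m) \<and>
     (\<forall>i\<in>{1..n}. real (s 2 i) = real n * budgets n m T P k i) \<and>
     (\<forall>j\<in>{1..k}. s 1 j = first_choice_budget_rule n m T P j)"

definition round_cost :: "nat \<Rightarrow> nat \<Rightarrow> nat" where
  "round_cost n m = for_cost m (Cell 0 (Const 1)) 16 + (for_cost n (var 0) 50 +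
     (6 + for_cost m (Cell 0 (Const 1)) 30 + (5 + (20 + for_cost n (var 0) 40))))"

lemma round_prog_halts:
  assumes P: "profile n m T P" and k: "k < T"
    and inv: "round_invariant n m T P k s" and s6: "s 6 0 = Suc k"
  shows "halts round_prog s (round_cost n m)
    (\<lambda>s'. round_invariant n m T P (Suc k) s' \<and> s' 6 0 = Suc k)"
proof -
  let ?b = "budgets n m T P k" and ?f = "first_choice P (Suc k)"
  let ?V = "first_voters n P (Suc k)"
  define w where "w = round_winner n m P (Suc k) ?b"
  have n1: "n \<ge> 1" using P by (simp add: profile_def)
  have f: "?f i \<in> {1..m}" if "i \<in> {1..n}" for i
    using first_choice_in[OF P _ that] k by auto
  have V: "{i\<in>{1..n}. ?f i = c} = ?V c" for c by (simp add: first_voters_def)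
  define key where "key = (\<lambda>c. (\<Sum>i\<in>?V c. s 2 i) + (if c \<in> ?f ` {1..n} then 1 else 0))"
  have s0: "s 0 0 = n" "s 0 1 = m" "s 0 (s 8 0 + (i - 1) * m) = ?f i" if "i \<in> {1..n}" for i
    using inv initial_store_parameters[of n m T P] initial_store_first_choice[OF P k, of "i - 1"] that
    by (auto simp: round_invariant_def)
  have real_sum: "real (\<Sum>i\<in>?V c. s 2 i) = real n * backing n P (Suc k) ?b c" for c
    using inv by (simp add: round_invariant_def backing_def first_voters_def sum_distrib_left)

  \<comment> \<open>\<open>?Q1\<close> to \<open>?Q4\<close> are the assertions after clearing,
    tallying, selecting and writing the winner, all relative to the store \<open>s\<close> at the
    start of the round.\<close>
  let ?Q1 = "\<lambda>t. same_except {3, 4, 7} s t \<and> (\<forall>c\<in>{1..m}. t 3 c = 0 \<and> t 4 c = 0)"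
  let ?Q2 = "\<lambda>t. same_except {3, 4, 5, 7, 8} s t \<and> t 8 0 = 3 + Suc k * (n * m) \<and>
    (\<forall>i\<in>{1..n}. t 5 i = ?f i) \<and> (\<forall>c\<in>{1..m}. t 3 c = (\<Sum>i\<in>?V c. s 2 i)) \<and>
    (\<forall>c\<in>{1..m}. t 3 c + t 4 c = key c)"
  let ?Q3 = "\<lambda>t. same_except {3, 4, 5, 7, 8, 9, 10} s t \<and> t 8 0 = 3 + Suc k * (n * m) \<and>
    (\<forall>i\<in>{1..n}. t 5 i = ?f i) \<and> t 3 w = (\<Sum>i\<in>?V w. s 2 i) \<and> t 9 0 = w"
  let ?Q4 = "\<lambda>t. same_except {1, 3, 4, 5, 7, 8, 9, 10} s t \<and> t 8 0 = 3 + Suc k * (n * m) \<and>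
    (\<forall>i\<in>{1..n}. t 5 i = ?f i) \<and> t 3 w = (\<Sum>i\<in>?V w. s 2 i) \<and> t 9 0 = w \<and> t 1 = (s 1)(Suc k := w)"

  have 1: "halts clear_prog s (for_cost m (Cell 0 (Const 1)) 16) ?Q1"
    using s0 n1 by (intro clear_prog_halts) auto
  have 2: "halts tally_prog t (for_cost n (var 0) 50) ?Q2" if t: "?Q1 t" for t
  proof -
    have eq: "t 0 = s 0" "t 8 = s 8" "t 2 = s 2" using t by (auto simp: same_except_def)
    have zero: "t 3 (?f i) = 0 \<and> t 4 (?f i) = 0" if "i \<in> {1..n}" for i using t f[OF that] by blast
    have "halts tally_prog t (for_cost n (var 0) 50)
      (\<lambda>s'. same_except {3, 4, 5, 7, 8} t s' \<and> s' 8 0 = t 8 0 + n * m \<and>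
       (\<forall>i\<in>{1..n}. s' 5 i = ?f i) \<and>
       (\<forall>c. s' 3 c = t 3 c + (\<Sum>i\<in>{i\<in>{1..n}. ?f i = c}. t 2 i)) \<and>
       (\<forall>c. s' 4 c = (if c \<in> ?f ` {1..n} then 1 else t 4 c)))"
      using s0 n1 zero by (intro tally_prog_halts) (auto simp: eq)
    then show ?thesis
      by (rule halts_mono, simp, unfold V eq)
        (use t inv in \<open>auto simp: same_except_def key_def round_invariant_def\<close>)
  qed
  have 3: "halts select_prog t (6 + for_cost m (Cell 0 (Const 1)) 30) ?Q3" if t: "?Q2 t" for t
  proof -
    have eq: "t 0 = s 0" using t by (auto simp: same_except_def)
    have key: "t 3 c + t 4 c = key c" if "c \<in> {1..m}" for c using t that by blast
    have pos: "\<exists>c\<in>{1..m}. t 3 c + t 4 c > 0"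
      using f[of 1] n1 by (intro bexI[of _ "?f 1"]) (auto simp: key key_def)
    have "halts select_prog t (6 + for_cost m (Cell 0 (Const 1)) 30)
      (\<lambda>s'. same_except {7, 9, 10} t s' \<and> s' 9 0 \<in> {1..m} \<and>
       (\<forall>c\<in>{1..m}. t 3 c + t 4 c \<le> t 3 (s' 9 0) + t 4 (s' 9 0)) \<and>
       (\<forall>c\<in>{1..<s' 9 0}. t 3 c + t 4 c < t 3 (s' 9 0) + t 4 (s' 9 0)))"
      using s0 n1 eq pos by (intro select_prog_halts) auto
    then show ?thesis
    proof (rule halts_mono)
      fix s' assume s': "same_except {7, 9, 10} t s' \<and> s' 9 0 \<in> {1..m} \<and>
       (\<forall>c\<in>{1..m}. t 3 c + t 4 c \<le> t 3 (s' 9 0) + t 4 (s' 9 0)) \<and>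
       (\<forall>c\<in>{1..<s' 9 0}. t 3 c + t 4 c < t 3 (s' 9 0) + t 4 (s' 9 0))"
      define v where "v = s' 9 0"
      have v: "v \<in> {1..m}" using s' by (simp add: v_def)
      have max: "key c \<le> key v" if "c \<in> {1..m}" for c
        using s' key that v by (metis v_def)
      have less: "key c < key v" if "c \<in> {1..m}" "c < v" for c
        using s' key[OF that(1)] key[OF v] that unfolding v_def
        by (metis atLeastAtMost_iff atLeastLessThan_iff)
      \<comment> \<open>The first choice of voter 1 has a positive key even if all budgets are
        spent, whereas a candidate who is nobody's first choice has key 0.\<close>
      have "key v > 0" using max[of "?f 1"] f[of 1] n1 by (force simp: key_def)
      moreover have "key v = 0" if "v \<notin> ?f ` {1..n}"
      proof -
        have "?V v = {}" using that by (auto simp: first_voters_def)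
        then show ?thesis using that by (simp add: key_def)
      qed
      ultimately have vf: "v \<in> ?f ` {1..n}" by (metis less_irrefl)
      have fc: "c \<in> first_choices n m P (Suc k) \<longleftrightarrow> c \<in> ?f ` {1..n}" for c
        using f by (auto simp: first_choices_def first_voters_def)
      have le_iff: "backing n P (Suc k) ?b c \<le> backing n P (Suc k) ?b c' \<longleftrightarrow> key c \<le> key c'"
        if "c \<in> ?f ` {1..n}" "c' \<in> ?f ` {1..n}" for c c'
      proof -
        \<comment> \<open>Both indicators are 1 and cancel.\<close>
        have "key c \<le> key c' \<longleftrightarrow> real (\<Sum>i\<in>?V c. s 2 i) \<le> real (\<Sum>i\<in>?V c'. s 2 i)"
          using that by (simp add: key_def del: of_nat_sum)
        then show ?thesis using n1 by (simp add: real_sum del: of_nat_sum)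
      qed
      have "w = v"
        unfolding w_def using vf f max less le_iff
        by (intro round_winner_eqI) (auto simp: fc not_le[symmetric])
      then show "?Q3 s'"
        using s' t v by (auto simp: same_except_def v_def)
    qed simp
  qed
  have 4: "halts (Assign 1 (var 6) (var 9)) t 5 ?Q4" if t: "?Q3 t" for t
  proof -
    have "t 6 = s 6" "t 1 = s 1" using t by (auto simp: same_except_def)
    then show ?thesis
      using halts_loop_free[of "Assign 1 (var 6) (var 9)" ?Q4 t] t s6
      by (simp add: same_except_def eval_nat_numeral)
  qed
  have 5: "halts deduct_prog t (20 + for_cost n (var 0) 40)
    (\<lambda>s'. round_invariant n m T P (Suc k) s' \<and> s' 6 0 = Suc k)" if t: "?Q4 t" for t
  proof -
    have eq: "t 0 = s 0" "t 2 = s 2" "t 6 = s 6" using t by (auto simp: same_except_def)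
    let ?q = "min n (\<Sum>i\<in>?V w. s 2 i)" and ?is = "filter (\<lambda>i. ?f i = w) [1..<n+1]"
    have filter: "filter (\<lambda>i. t 5 i = t 9 0) [1..<n+1] = ?is"
      using t by (intro filter_cong) auto
    have q: "real ?q = real n * min 1 (backing n P (Suc k) ?b w)"
      using real_sum[of w] n1 by (simp add: of_nat_min min_mult_distrib_left del: of_nat_sum)
    have "halts deduct_prog t (20 + for_cost n (var 0) 40)
      (\<lambda>s'. same_except {2, 7, 11, 12} t s' \<and>
       s' 2 = snd (fold take_from (filter (\<lambda>i. t 5 i = t 9 0) [1..<n+1]) (min n (t 3 (t 9 0)), t 2)))"
      using s0 n1 eq by (intro deduct_prog_halts) auto
    then have "halts deduct_prog t (20 + for_cost n (var 0) 40)
      (\<lambda>s'. same_except {2, 7, 11, 12} t s' \<and> s' 2 = snd (fold take_from ?is (?q, s 2)))"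
      using t unfolding filter eq by simp
    then show ?thesis
    proof (rule halts_mono)
      fix s' assume s': "same_except {2, 7, 11, 12} t s' \<and> s' 2 = snd (fold take_from ?is (?q, s 2))"
      have "real (s' 2 i) = real n * budgets n m T P (Suc k) i" if "i \<in> {1..n}" for i
      proof -
        have "real (s' 2 i) = real n * deduct ?is (min 1 (backing n P (Suc k) ?b w)) ?b i"
          unfolding conjunct2[OF s']
        proof (rule fold_take_from[where A = "{1..n}", OF _ q _ n1 that])
          show "set ?is \<subseteq> {1..n}" by auto
        qed (use inv in \<open>simp add: round_invariant_def\<close>)
        then show ?thesis
          by (simp add: Let_def w_def sorted_list_of_first_voters del: deduct.simps upt_Suc)
      qed
      moreover have "s' 1 j = first_choice_budget_rule n m T P j" if "j \<in> {1..Suc k}" for j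
        using s' t inv that
        by (auto simp: same_except_def round_invariant_def le_Suc_eq first_choice_budget_rule_def w_def)
      moreover have "s' 0 = s 0" "s' 8 = t 8" "s' 6 = s 6"
        using s' t by (auto simp: same_except_def)
      ultimately show "round_invariant n m T P (Suc k) s' \<and> s' 6 0 = Suc k"
        using t inv s6 by (simp add: round_invariant_def del: budgets.simps)
    qed simp
  qed
  show ?thesis
    unfolding round_prog_def round_cost_def
    by (rule halts_Seq[OF 1 halts_Seq[OF 2 halts_Seq[OF 3 halts_Seq[OF 4 5]]]])
qed

section \<open>The whole program and its running time\<close>

lemma rule_prog_halts:
  assumes P: "profile n m T P"
  shows "halts rule_prog (initial_store (encode n m T P))
    (for_cost n (var 0) 8 + (3 + for_cost T (Cell 0 (Const 2)) (round_cost n m)))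
    (round_invariant n m T P T)"
proof -
  let ?s = "initial_store (encode n m T P)"
  have n1: "n \<ge> 1" using P by (simp add: profile_def)
  let ?Q = "\<lambda>t. same_except {2, 7} ?s t \<and> (\<forall>i\<in>{1..n}. t 2 i = T)"
  let ?Q' = "\<lambda>t. same_except {2, 7, 8} ?s t \<and> (\<forall>i\<in>{1..n}. t 2 i = T) \<and> t 8 0 = 3"
  have 1: "halts init_prog ?s (for_cost n (var 0) 8) ?Q"
    using init_prog_halts[of ?s n] by (simp add: initial_store_parameters)
  have 2: "halts (set_var 8 (Const 3)) t 3 ?Q'" if "?Q t" for t
    using halts_loop_free[of "set_var 8 (Const 3)" ?Q' t] that
    by (simp add: same_except_def eval_nat_numeral)
  have 3: "halts (for_loop 6 (Cell 0 (Const 2)) round_prog) t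
      (for_cost T (Cell 0 (Const 2)) (round_cost n m)) (round_invariant n m T P T)" if t: "?Q' t" for t
  proof (rule halts_for_loop[where I = "round_invariant n m T P"])
    show "round_invariant n m T P 0 (t(6 := (t 6)(0 := 0)))"
      using t n1 by (auto simp: round_invariant_def same_except_def)
  next
    fix k s assume "round_invariant n m T P k s"
    then show "val (Cell 0 (Const 2)) s = T"
      by (simp add: round_invariant_def initial_store_parameters)
  next
    fix k s assume "k < T" "round_invariant n m T P k s"
    then show "halts round_prog (s(6 := (s 6)(0 := Suc k))) (round_cost n m)
        (\<lambda>s'. round_invariant n m T P (Suc k) s' \<and> s' 6 0 = Suc k)"
      by (intro round_prog_halts[OF P]) (auto simp: round_invariant_def)
  qed
  show ?thesis
    unfolding rule_prog_def by (rule halts_Seq[OF 1 halts_Seq[OF 2 3]])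
qed

text \<open>The time is of order \<open>T * (n + m)\<close>, hence linear in the input length
  \<open>3 + T * (n * m)\<close>, since all parameters are at least 1. The factor 1000 is a generous
  choice.\<close>

lemma polynomial_time_first_choice_budget_rule: "polynomial_time_rule first_choice_budget_rule"
  unfolding polynomial_time_rule_def
proof (intro exI[of _ rule_prog] exI[of _ "[:0, 1000:]"] allI impI)
  fix n m T P assume P: "profile n m T P"
  let ?l = "T * (n * m)"
  have ge: "n \<ge> 1" "m \<ge> 1" "T \<ge> 1" using P by (auto simp: profile_def)
  obtain t s where ts: "exec rule_prog (initial_store (encode n m T P)) t s"
    "t \<le> for_cost n (var 0) 8 + (3 + for_cost T (Cell 0 (Const 2)) (round_cost n m))"
    "round_invariant n m T P T s"
    using rule_prog_halts[OF P] by (auto simp: halts_def)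
  have le: "n \<le> ?l" "T \<le> ?l" "T * n \<le> ?l" "T * m \<le> ?l" using ge by auto
  have "t \<le> 21 + 20 * n + 79 * T + 70 * (T * m) + 114 * (T * n)"
    using ts(2) by (simp add: for_cost_def round_cost_def algebra_simps)
  also have "\<dots> \<le> 21 + 20 * ?l + 79 * ?l + 70 * ?l + 114 * ?l"
    by (intro add_mono mult_le_mono le order_refl)
  also have "\<dots> \<le> 1000 * (3 + ?l)" by simp
  finally have "t \<le> 1000 * (3 + ?l)" .
  then show "\<exists>t s. exec rule_prog (initial_store (encode n m T P)) t s \<and>
      t \<le> poly [:0, 1000:] (length (encode n m T P)) \<and>
      (\<forall>j\<in>{1..T}. s 1 j = first_choice_budget_rule n m T P j)"
    using ts(1,3) by (auto simp: length_encode[OF P] round_invariant_def mult.commute)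
qed

theorem theorem5p1:
  fixes d :: nat
  assumes "d \<ge> 2"
  shows "semi_online_rule first_choice_budget_rule \<and>
    polynomial_time_rule first_choice_budget_rule \<and>
    (\<forall>n m T P. profile n m T P \<and> at_most_first_choices d n m T P \<longrightarrow>
       (\<forall>S. voter_group n S \<longrightarrow>
          int (card {j\<in>{1..T}. \<exists>i\<in>S. first_choice_budget_rule n m T P j = first_choice P j i})
            \<ge> \<lfloor>real (card S) * real T / real n\<rfloor> - int (Delta d)) \<and>
       all_rank_PJR n m T P (Delta d) (first_choice_budget_rule n m T P)) \<and>
    (\<forall>L<Delta d.
       (\<exists>n m T P. profile n m T P \<and> at_most_first_choices d n m T P \<and>
          (\<forall>W. winner_sequence m T W \<longrightarrow> \<not> all_rank_wPJR n m T P L W)) \<and>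
       \<not> (\<exists>F. offline_rule F \<and>
            (\<forall>n m T P. profile n m T P \<and> at_most_first_choices d n m T P \<longrightarrow>
               all_rank_wPJR n m T P L (F n m T P))))"
proof -
  have "1 \<le> d" using assms by simp
  then show ?thesis
    using semi_online_first_choice_budget_rule polynomial_time_first_choice_budget_rule
      budget_rule_first_choice_rounds budget_rule_all_rank_PJR
      no_smaller_loss[OF assms] no_rule_with_smaller_loss[OF assms]
    by (auto simp: voter_group_def)
qed

end
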